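(* Let $M$ be a differentiable manifold. Along any $C^1$ path $\gamma:J\to M$ ($J\subset\mathbb R$ an interval) there exists a basis $\{E_{i'}\}$ in which the components of a given $S$-derivation $\mathcal D^\gamma$ along $\gamma$ are zeros.
   Context: $S$ is a fixed map assigning to each $C^1$ vector field $X$ a tensor field $S_X$ of type $(1,1)$, regarded as a derivation of the tensor algebra over $M$; $D_X=L_X+S_X$, where $L_X$ is the Lie derivative along $X$. In a local basis $\{E_i\}$ of vector fields the components $W_X=[(W_X)^i_{\ j}]$ of $D_X$ are defined by $D_X(E_j)=(W_X)^i_{\ j}E_i$ (summation convention). Under a change $E_{i'}=A^i_{\ i'}E_i$ with $A=[A^i_{\ i'}]$ a nondegenerate matrix function, they become $A^{-1}(W_XA+X(A))$, where $X(A)$ is the entrywise action of $X$ on $A$. Let $X$ be a $C^1$ vector field defined on a neighborhood of $\gamma(J)$ which on $\gamma(J)$ reduces to the tangent vector field of $\gamma$, i.e. $X|_{\gamma(s)}=\dot\gamma(s)$ for $s\in J$. The restriction of $D_X$ to $\gamma(J)$ is called an $S$-derivation along $\gamma$ and denoted $\mathcal D^\gamma$: for a $C^1$ tensor field $T$ in a neighborhood of $\gamma(J)$, $(\mathcal D^\gamma T)|_{\gamma(s)}=(D_XT)|_{\gamma(s)}$. The components of $\mathcal D^\gamma$ in a basis of vector fields in a neighborhood of $\gamma(J)$ are the components of $D_X$ in that basis restricted to $\gamma(J)$.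
   Formalization: A basis of vector fields near γ(J) is claimed only if γ is a homeomorphism onto γ(J) (false e.g. for constant or periodic γ); for every C¹ path the basis is a C¹ frame depending on s∈J. The tensor fields S_X are assumed continuous, J has more than one point, and dim M ≥ 1. *)

theory Defs
  imports "HOL-Analysis.Analysis"
begin

section \<open>Maps of class C1 and C2\<close>

definition C1_on :: "'a::real_normed_vector set \<Rightarrow> ('a \<Rightarrow> 'b::real_normed_vector) \<Rightarrow> bool" where
  "C1_on S f \<longleftrightarrow>
     (\<exists>f'. (\<forall>x\<in>S. (f has_derivative blinfun_apply (f' x)) (at x)) \<and> continuous_on S f')"

definition C2_on :: "'a::real_normed_vector set \<Rightarrow> ('a \<Rightarrow> 'b::real_normed_vector) \<Rightarrow> bool" where
  "C2_on S f \<longleftrightarrow>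
     (\<exists>f'. (\<forall>x\<in>S. (f has_derivative blinfun_apply (f' x)) (at x)) \<and> C1_on S f')"

text \<open>Curves are differentiated within their interval \<open>J\<close> (one-sidedly at an end point
  belonging to \<open>J\<close>); \<open>K\<close> is the part of \<open>J\<close> on which the curve is considered.\<close>

definition C1_curve_on :: "real set \<Rightarrow> real set \<Rightarrow> (real \<Rightarrow> 'b::real_normed_vector) \<Rightarrow> bool" where
  "C1_curve_on J K g \<longleftrightarrow>
     (\<exists>g'. (\<forall>t\<in>K. (g has_vector_derivative g' t) (at t within J)) \<and> continuous_on K g')"


section \<open>Manifolds\<close>

text \<open>A chart is its domain together with its coordinate map. The manifold is the whole type
  \<open>'m\<close>. An atlas of class C2 is what is needed to speak about C1 vector fields; in particular
  every smooth atlas is admitted.\<close>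

type_synonym ('m, 'n) chart = "'m set \<times> ('m \<Rightarrow> real^'n)"

definition param :: "('m, 'n) chart \<Rightarrow> real^'n \<Rightarrow> 'm" where
  "param c = inv_into (fst c) (snd c)"

definition C2_atlas :: "('m::topological_space, 'n::finite) chart set \<Rightarrow> bool" where
  "C2_atlas A \<longleftrightarrow>
     (\<Union>c\<in>A. fst c) = UNIV \<and>
     (\<forall>c\<in>A. open (fst c) \<and> open (snd c ` fst c) \<and>
             homeomorphism (fst c) (snd c ` fst c) (snd c) (param c)) \<and>
     (\<forall>c\<in>A. \<forall>d\<in>A. C2_on (snd c ` (fst c \<inter> fst d)) (snd d \<circ> param c))"

definition charts_at :: "('m, 'n) chart set \<Rightarrow> 'm \<Rightarrow> ('m, 'n) chart set" where
  "charts_at A p = {c \<in> A. p \<in> fst c}"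

text \<open>The partial derivative at \<open>p\<close> of \<open>f\<close> with respect to the \<open>k\<close>-th coordinate of \<open>c\<close>.\<close>

definition pd :: "('m, 'n::finite) chart \<Rightarrow> 'n \<Rightarrow> ('m \<Rightarrow> real) \<Rightarrow> 'm \<Rightarrow> real" where
  "pd c k f p = frechet_derivative (f \<circ> param c) (at (snd c p)) (axis k 1)"

definition jac :: "('m, 'n::finite) chart \<Rightarrow> ('m, 'n) chart \<Rightarrow> 'm \<Rightarrow> 'n \<Rightarrow> 'n \<Rightarrow> real" where
  "jac c d p i k = pd c k (\<lambda>q. snd d q $ i) p"


section \<open>Tensors\<close>

text \<open>A tensor at a point is given by its components in all charts around that point: \<open>t c I J\<close>
  is the component in the chart \<open>c\<close> with list \<open>I\<close> of contravariant and list \<open>J\<close> of covariant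
  indices. Only charts around the point and lists whose lengths match the type of the tensor
  are meaningful. Tangent vectors are the tensors of type (1,0).\<close>

type_synonym ('m, 'n) tensor = "('m, 'n) chart \<Rightarrow> 'n list \<Rightarrow> 'n list \<Rightarrow> real"

definition tensor_at ::
  "('m, 'n::finite) chart set \<Rightarrow> nat \<Rightarrow> nat \<Rightarrow> 'm \<Rightarrow> ('m, 'n) tensor \<Rightarrow> bool" where
  "tensor_at A r s p t \<longleftrightarrow>
     (\<forall>c\<in>charts_at A p. \<forall>d\<in>charts_at A p. \<forall>I J. length I = r \<longrightarrow> length J = s \<longrightarrow>
        t d I J = (\<Sum>K | length K = r. \<Sum>L | length L = s.
          (\<Prod>a<r. jac c d p (I!a) (K!a)) * (\<Prod>b<s. jac d c p (L!b) (J!b)) * t c K L))"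

definition C0_tensor_field ::
  "('m::topological_space, 'n::finite) chart set \<Rightarrow> nat \<Rightarrow> nat \<Rightarrow> 'm set \<Rightarrow>
   ('m \<Rightarrow> ('m, 'n) tensor) \<Rightarrow> bool" where
  "C0_tensor_field A r s U T \<longleftrightarrow>
     (\<forall>p\<in>U. tensor_at A r s p (T p)) \<and>
     (\<forall>c\<in>A. \<forall>I J. length I = r \<longrightarrow> length J = s \<longrightarrow>
        continuous_on (U \<inter> fst c) (\<lambda>p. T p c I J))"

definition C1_tensor_field ::
  "('m::topological_space, 'n::finite) chart set \<Rightarrow> nat \<Rightarrow> nat \<Rightarrow> 'm set \<Rightarrow>
   ('m \<Rightarrow> ('m, 'n) tensor) \<Rightarrow> bool" where
  "C1_tensor_field A r s U T \<longleftrightarrow>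
     (\<forall>p\<in>U. tensor_at A r s p (T p)) \<and>
     (\<forall>c\<in>A. \<forall>I J. length I = r \<longrightarrow> length J = s \<longrightarrow>
        C1_on (snd c ` (U \<inter> fst c)) ((\<lambda>p. T p c I J) \<circ> param c))"

abbreviation C1_vector_field ::
  "('m::topological_space, 'n::finite) chart set \<Rightarrow> 'm set \<Rightarrow> ('m \<Rightarrow> ('m, 'n) tensor) \<Rightarrow> bool" where
  "C1_vector_field A \<equiv> C1_tensor_field A 1 0"

text \<open>A basis of the tangent space at \<open>p\<close>; \<open>e j c [i] []\<close> is the \<open>i\<close>-th coordinate of the \<open>j\<close>-th
  basis vector.\<close>

definition basis_at ::
  "('m, 'n::finite) chart set \<Rightarrow> 'm \<Rightarrow> ('n \<Rightarrow> ('m, 'n) tensor) \<Rightarrow> bool" where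
  "basis_at A p e \<longleftrightarrow>
     (\<forall>j. tensor_at A 1 0 p (e j)) \<and>
     (\<forall>c\<in>charts_at A p. invertible ((\<chi> i j. e j c [i] []) :: real^'n^'n))"

definition C1_basis_on ::
  "('m::topological_space, 'n::finite) chart set \<Rightarrow> 'm set \<Rightarrow> ('n \<Rightarrow> 'm \<Rightarrow> ('m, 'n) tensor) \<Rightarrow> bool"
  where
  "C1_basis_on A V E \<longleftrightarrow>
     (\<forall>j. C1_vector_field A V (E j)) \<and> (\<forall>p\<in>V. basis_at A p (\<lambda>j. E j p))"

text \<open>The vectors \<open>v j\<close> have the components \<open>W\<close> (column \<open>j\<close> belonging to \<open>v j\<close>) in the basis \<open>e\<close>:
  \<open>v j = W $ k $ j e k\<close>, summed over \<open>k\<close>.\<close>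

definition has_components ::
  "('m, 'n::finite) chart set \<Rightarrow> 'm \<Rightarrow> ('n \<Rightarrow> ('m, 'n) tensor) \<Rightarrow> ('n \<Rightarrow> ('m, 'n) tensor) \<Rightarrow>
   real^'n^'n \<Rightarrow> bool" where
  "has_components A p e v W \<longleftrightarrow>
     (\<forall>c\<in>charts_at A p. \<forall>i j. v j c [i] [] = (\<Sum>k\<in>UNIV. W $ k $ j * e k c [i] []))"


section \<open>S-derivations\<close>

text \<open>The action on tensors of the endomorphism with matrix \<open>B\<close>, as the derivation of the tensor
  algebra that commutes with contractions and vanishes on scalars.\<close>

definition endo_action ::
  "('n::finite \<Rightarrow> 'n \<Rightarrow> real) \<Rightarrow> ('n list \<Rightarrow> 'n list \<Rightarrow> real) \<Rightarrow> 'n list \<Rightarrow> 'n list \<Rightarrow> real" where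
  "endo_action B t I J =
     (\<Sum>a<length I. \<Sum>k\<in>UNIV. B (I!a) k * t (I[a:=k]) J) -
     (\<Sum>b<length J. \<Sum>k\<in>UNIV. B k (J!b) * t I (J[b:=k]))"

text \<open>The coordinate expression of the Lie derivative: on vector fields it is
  \<open>X\<^sup>k \<partial>\<^sub>k Y\<^sup>i - Y\<^sup>k \<partial>\<^sub>k X\<^sup>i\<close>, and each further index contributes a term of the same kind.\<close>

definition lie_derivative ::
  "('m \<Rightarrow> ('m, 'n::finite) tensor) \<Rightarrow> ('m \<Rightarrow> ('m, 'n) tensor) \<Rightarrow> 'm \<Rightarrow> ('m, 'n) tensor" where
  "lie_derivative X T p c I J =
     (\<Sum>k\<in>UNIV. X p c [k] [] * pd c k (\<lambda>q. T q c I J) p) +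
     endo_action (\<lambda>i k. - pd c k (\<lambda>q. X q c [i] []) p) (T p c) I J"

definition S_derivation ::
  "(('m \<Rightarrow> ('m, 'n::finite) tensor) \<Rightarrow> 'm \<Rightarrow> ('m, 'n) tensor) \<Rightarrow>
   ('m \<Rightarrow> ('m, 'n) tensor) \<Rightarrow> ('m \<Rightarrow> ('m, 'n) tensor) \<Rightarrow> 'm \<Rightarrow> ('m, 'n) tensor" where
  "S_derivation S X T p c I J =
     lie_derivative X T p c I J + endo_action (\<lambda>i k. S X p c [i] [k]) (T p c) I J"


section \<open>S-derivations along a path\<close>

definition C1_path ::
  "('m::topological_space, 'n::finite) chart set \<Rightarrow> real set \<Rightarrow> (real \<Rightarrow> 'm) \<Rightarrow> bool" where
  "C1_path A J \<gamma> \<longleftrightarrow>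
     continuous_on J \<gamma> \<and> (\<forall>c\<in>A. C1_curve_on J {t\<in>J. \<gamma> t \<in> fst c} (snd c \<circ> \<gamma>))"

definition velocity :: "real set \<Rightarrow> (real \<Rightarrow> 'm) \<Rightarrow> real \<Rightarrow> ('m, 'n::finite) chart \<Rightarrow> real^'n" where
  "velocity J \<gamma> s c = vector_derivative (snd c \<circ> \<gamma>) (at s within J)"

definition reduces_to_tangent ::
  "('m, 'n::finite) chart set \<Rightarrow> real set \<Rightarrow> (real \<Rightarrow> 'm) \<Rightarrow> ('m \<Rightarrow> ('m, 'n) tensor) \<Rightarrow> bool" where
  "reduces_to_tangent A J \<gamma> X \<longleftrightarrow>
     (\<forall>s\<in>J. \<forall>c\<in>charts_at A (\<gamma> s). \<forall>i. X (\<gamma> s) c [i] [] = velocity J \<gamma> s c $ i)"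

text \<open>A basis along a path is a family of bases of the spaces tangent at \<open>\<gamma> s\<close>, of class C1 in the
  parameter \<open>s\<close>. At a point passed several times by the path there is one basis for each
  passage.\<close>

definition C1_tensor_along ::
  "('m::topological_space, 'n::finite) chart set \<Rightarrow> nat \<Rightarrow> nat \<Rightarrow> real set \<Rightarrow> (real \<Rightarrow> 'm) \<Rightarrow>
   (real \<Rightarrow> ('m, 'n) tensor) \<Rightarrow> bool" where
  "C1_tensor_along A r q J \<gamma> T \<longleftrightarrow>
     (\<forall>s\<in>J. tensor_at A r q (\<gamma> s) (T s)) \<and>
     (\<forall>c\<in>A. \<forall>I L. length I = r \<longrightarrow> length L = q \<longrightarrow>
        C1_curve_on J {t\<in>J. \<gamma> t \<in> fst c} (\<lambda>t. T t c I L))"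

definition C1_basis_along ::
  "('m::topological_space, 'n::finite) chart set \<Rightarrow> real set \<Rightarrow> (real \<Rightarrow> 'm) \<Rightarrow>
   ('n \<Rightarrow> real \<Rightarrow> ('m, 'n) tensor) \<Rightarrow> bool" where
  "C1_basis_along A J \<gamma> E \<longleftrightarrow>
     (\<forall>j. C1_tensor_along A 1 0 J \<gamma> (E j)) \<and> (\<forall>s\<in>J. basis_at A (\<gamma> s) (\<lambda>j. E j s))"

text \<open>The S-derivation along \<open>\<gamma>\<close>, on tensor fields given only along \<open>\<gamma>\<close>: since \<open>X\<close> is tangent to
  \<open>\<gamma>\<close>, the term \<open>X\<^sup>k \<partial>\<^sub>k T\<close> of \<^const>\<open>S_derivation\<close> is the derivative of \<open>T\<close> with respect to the
  path parameter. The lemmas below show that it agrees with \<^const>\<open>S_derivation\<close> on the fields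
  defined in a neighbourhood of the path, and that it is additive and satisfies the Leibniz rule.
  These properties determine it: if \<open>E' j s = a i j s E i (\<gamma> s)\<close> (summed over \<open>i\<close>), then its components
  in \<open>E'\<close> are the entries of \<open>inverse a (W a + a')\<close>, where \<open>W\<close> are those of \<^const>\<open>S_derivation\<close> in \<open>E\<close>.\<close>

definition S_derivation_along ::
  "real set \<Rightarrow> (real \<Rightarrow> 'm) \<Rightarrow> (('m \<Rightarrow> ('m, 'n::finite) tensor) \<Rightarrow> 'm \<Rightarrow> ('m, 'n) tensor) \<Rightarrow>
   ('m \<Rightarrow> ('m, 'n) tensor) \<Rightarrow> (real \<Rightarrow> ('m, 'n) tensor) \<Rightarrow> real \<Rightarrow> ('m, 'n) tensor" where
  "S_derivation_along J \<gamma> S X T s c I L =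
     vector_derivative (\<lambda>t. T t c I L) (at s within J) +
     endo_action (\<lambda>i k. S X (\<gamma> s) c [i] [k] - pd c k (\<lambda>q. X q c [i] []) (\<gamma> s)) (T s c) I L"

lemma endo_action_add_matrix:
  "endo_action (\<lambda>i k. B i k + C i k) t I J = endo_action B t I J + endo_action C t I J"
  unfolding endo_action_def by (simp add: sum.distrib algebra_simps)

lemma endo_action_add:
  "endo_action B (\<lambda>I J. t I J + u I J) I J = endo_action B t I J + endo_action B u I J"
  unfolding endo_action_def by (simp add: sum.distrib algebra_simps)

lemma endo_action_scale:
  "endo_action B (\<lambda>I J. x * t I J) I J = x * endo_action B t I J"
  unfolding endo_action_def by (simp add: sum_distrib_left algebra_simps)

lemma S_derivation_along_restrict:
  fixes A :: "('m::topological_space, 'n::finite) chart set"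
  assumes A: "C2_atlas A" and J: "is_interval J" "a \<in> J" "b \<in> J" "a < b"
    and path: "C1_path A J \<gamma>" and U: "open U" "\<gamma> ` J \<subseteq> U"
    and X: "reduces_to_tangent A J \<gamma> X"
    and T: "C1_tensor_field A r q U T"
    and s: "s \<in> J" and c: "c \<in> charts_at A (\<gamma> s)" and len: "length I = r" "length L = q"
  shows "S_derivation_along J \<gamma> S X (\<lambda>t. T (\<gamma> t)) s c I L = S_derivation S X T (\<gamma> s) c I L"
proof -
  have cA: "c \<in> A" and sc: "\<gamma> s \<in> fst c" using c by (auto simp: charts_at_def)
  have oc: "open (fst c)" and hom: "homeomorphism (fst c) (snd c ` fst c) (snd c) (param c)"
    using A cA by (auto simp: C2_atlas_def)
  have inv: "param c (snd c p) = p" if "p \<in> fst c" for p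
    using hom that by (auto simp: homeomorphism_def)
  have nontriv: "at s within J \<noteq> bot"
  proof -
    have "connected J" using J(1) is_interval_connected by blast
    then show ?thesis
      using connected_imp_perfect[of J s] s J
      by (metis islimpt_UNIV less_irrefl singletonD trivial_limit_within)
  qed
  define v where "v = velocity J \<gamma> s c"
  obtain g' where "\<forall>t\<in>{t\<in>J. \<gamma> t \<in> fst c}. ((snd c \<circ> \<gamma>) has_vector_derivative g' t) (at t within J)"
    using path cA unfolding C1_path_def C1_curve_on_def by blast
  then have "((snd c \<circ> \<gamma>) has_vector_derivative g' s) (at s within J)" using s sc by auto
  then have vd: "((snd c \<circ> \<gamma>) has_vector_derivative v) (at s within J)"
    unfolding v_def velocity_def using vector_derivative_within[OF nontriv] by metis
  define f where "f = (\<lambda>p. T p c I L) \<circ> param c"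
  have "C1_on (snd c ` (U \<inter> fst c)) f"
    using T cA len unfolding C1_tensor_field_def f_def by blast
  then obtain f' where "\<forall>x\<in>snd c ` (U \<inter> fst c). (f has_derivative blinfun_apply (f' x)) (at x)"
    unfolding C1_on_def by blast
  moreover have "snd c (\<gamma> s) \<in> snd c ` (U \<inter> fst c)" using U(2) s sc by auto
  ultimately have "(f has_derivative blinfun_apply (f' (snd c (\<gamma> s)))) (at (snd c (\<gamma> s)))" by blast
  then have fd: "(f has_derivative frechet_derivative f (at (snd c (\<gamma> s)))) (at (snd c (\<gamma> s)))"
    using frechet_derivative_works differentiable_def by blast
  let ?D = "frechet_derivative f (at (snd c (\<gamma> s)))"
  have lin: "linear ?D" using fd has_derivative_linear by blast
  have "(f \<circ> (snd c \<circ> \<gamma>) has_derivative ?D \<circ> (\<lambda>h. h *\<^sub>R v)) (at s within J)"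
    using vd fd unfolding has_vector_derivative_def
    by (intro diff_chain_within) (auto intro: has_derivative_at_withinI)
  moreover have "?D \<circ> (\<lambda>h. h *\<^sub>R v) = (\<lambda>h. h *\<^sub>R ?D v)"
    using lin by (auto simp: linear_cmul)
  ultimately have comp: "(f \<circ> (snd c \<circ> \<gamma>) has_vector_derivative ?D v) (at s within J)"
    by (simp add: has_vector_derivative_def)
  have "continuous_on J \<gamma>" using path by (simp add: C1_path_def)
  then have "\<forall>\<^sub>F t in at s within J. \<gamma> t \<in> fst c"
    using s sc oc by (auto simp: continuous_on_def dest: topological_tendstoD)
  then have ev: "\<forall>\<^sub>F t in at s within J. (f \<circ> (snd c \<circ> \<gamma>)) t = T (\<gamma> t) c I L"
    by eventually_elim (simp add: f_def inv)
  have at_s: "(f \<circ> (snd c \<circ> \<gamma>)) s = T (\<gamma> s) c I L" using sc by (simp add: f_def inv)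
  have "((\<lambda>t. T (\<gamma> t) c I L) has_vector_derivative ?D v) (at s within J)"
    using has_derivative_transform_eventually[OF comp[unfolded has_vector_derivative_def] ev at_s s]
    by (simp add: has_vector_derivative_def)
  then have 1: "vector_derivative (\<lambda>t. T (\<gamma> t) c I L) (at s within J) = ?D v"
    using vector_derivative_within[OF nontriv] by blast
  have "v = (\<Sum>k\<in>UNIV. (v $ k) *\<^sub>R axis k 1)"
    by (metis (no_types, lifting) basis_expansion sum.cong scalar_mult_eq_scaleR)
  then have "?D v = ?D (\<Sum>k\<in>UNIV. (v $ k) *\<^sub>R axis k 1)" by simp
  also have "\<dots> = (\<Sum>k\<in>UNIV. v $ k * ?D (axis k 1))"
    using lin by (simp add: linear_sum linear_cmul)
  also have "\<dots> = (\<Sum>k\<in>UNIV. X (\<gamma> s) c [k] [] * pd c k (\<lambda>q. T q c I L) (\<gamma> s))"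
    using X s c unfolding reduces_to_tangent_def v_def pd_def f_def by auto
  finally have 2: "?D v = \<dots>" .
  have "(\<lambda>i k. S X (\<gamma> s) c [i] [k] - pd c k (\<lambda>q. X q c [i] []) (\<gamma> s)) =
        (\<lambda>i k. (- pd c k (\<lambda>q. X q c [i] []) (\<gamma> s)) + S X (\<gamma> s) c [i] [k])"
    by auto
  then show ?thesis
    by (simp only: S_derivation_along_def S_derivation_def lie_derivative_def 1 2
        endo_action_add_matrix)
qed

lemma S_derivation_along_add:
  assumes "at s within J \<noteq> bot"
    and "(\<lambda>t. T t c I L) differentiable at s within J"
    and "(\<lambda>t. T' t c I L) differentiable at s within J"
  shows "S_derivation_along J \<gamma> S X (\<lambda>t c I L. T t c I L + T' t c I L) s c I L =
         S_derivation_along J \<gamma> S X T s c I L + S_derivation_along J \<gamma> S X T' s c I L"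
proof -
  have "((\<lambda>t. T t c I L + T' t c I L) has_vector_derivative
        vector_derivative (\<lambda>t. T t c I L) (at s within J) +
        vector_derivative (\<lambda>t. T' t c I L) (at s within J)) (at s within J)"
    using assms by (intro has_vector_derivative_add) (auto simp: vector_derivative_works[symmetric])
  then have "vector_derivative (\<lambda>t. T t c I L + T' t c I L) (at s within J) =
        vector_derivative (\<lambda>t. T t c I L) (at s within J) +
        vector_derivative (\<lambda>t. T' t c I L) (at s within J)"
    using vector_derivative_within[OF assms(1)] by blast
  then show ?thesis by (simp add: S_derivation_along_def endo_action_add)
qed

lemma S_derivation_along_Leibniz:
  fixes f :: "real \<Rightarrow> real"
  assumes "at s within J \<noteq> bot"
    and "(f has_vector_derivative f') (at s within J)"
    and "(\<lambda>t. T t c I L) differentiable at s within J"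
  shows "S_derivation_along J \<gamma> S X (\<lambda>t c I L. f t * T t c I L) s c I L =
         f' * T s c I L + f s * S_derivation_along J \<gamma> S X T s c I L"
proof -
  have "((\<lambda>t. f t * T t c I L) has_vector_derivative
        f s * vector_derivative (\<lambda>t. T t c I L) (at s within J) + f' * T s c I L) (at s within J)"
    using assms by (intro has_vector_derivative_mult) (auto simp: vector_derivative_works[symmetric])
  then have "vector_derivative (\<lambda>t. f t * T t c I L) (at s within J) =
        f s * vector_derivative (\<lambda>t. T t c I L) (at s within J) + f' * T s c I L"
    using vector_derivative_within[OF assms(1)] by blast
  then show ?thesis by (simp add: S_derivation_along_def endo_action_scale algebra_simps)
qed

end

theory Submission
  imports Defs
begin

text \<open>The equation for the basis is a linear ordinary differential equation, and that is why it has
solutions along the whole path. If the vectors of a basis along \<open>\<gamma>\<close> have, in the coordinates of a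
chart \<open>c\<close>, the columns of the matrix \<open>F\<close>, then their images under the \<open>S\<close>-derivation have the
columns of \<open>F' + W F\<close>, where \<open>W\<close> is the matrix of the components of \<open>D\<^sub>X\<close> in the coordinate basis
(\<open>chart_components\<close> below). So the components vanish in the new basis if and only if
\<open>F' = - W F\<close>; such a family \<open>F\<close> is called parallel.

For the first half of the theorem this equation is solved on all of \<open>J\<close>. Inside one chart and on a
short interval a solution comes from the contraction principle (\<open>linear_ODE_local\<close>). The equation
has the same form in all charts (\<open>parallel_transform\<close>): the derivative of the Jacobian matrix along
\<open>\<gamma>\<close> is cancelled by the inhomogeneous term in the transformation of the derivatives of \<open>X\<close>, and
this is where the symmetry of the second derivatives of a coordinate change enters. Hence local
solutions can be adjusted by a constant matrix and joined, which reaches every compact subinterval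
(\<open>parallel_exists_compact\<close>), and by uniqueness (\<open>parallel_unique\<close>) the normalized solutions on
the compact subintervals fit together (\<open>parallel_frame_exists\<close>).

For the second half \<open>\<gamma>\<close> is an embedding in the topological sense, and the parallel basis has to be
extended to a neighbourhood of the path. The path is an integral curve of the field \<open>X\<close>, so a zero of
its velocity would make it constant nearby; since it is injective, the velocity has no zero
(\<open>velocity_nonzero\<close>). Therefore one of the coordinates is locally a C1 parameter of the path, and the
parallel basis, written as a function of this coordinate, extends to an open set
(\<open>local_extension\<close>). A path homeomorphic to its image does not return to that set at a distant
parameter, so the extension is right for all of \<open>\<gamma>\<close>. Countably many local extensions are glued by
a partition of unity (\<open>glue_frame_pieces\<close>). All of them agree on the path, so the glued field
restricts to the parallel basis there, and it is still a basis near the path because invertibility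
is an open condition. On the path its \<open>S\<close>-derivative depends on its restriction only, so it
vanishes.\<close>

section \<open>Symmetry of second derivatives\<close>

text \<open>The second difference is the increment of \<open>r \<mapsto> f (x + t u + r v) - f (x + r v)\<close> over \<open>[0, t]\<close>. Its
derivative in \<open>r\<close> is a difference of two values of \<open>f'\<close>, which the derivative of \<open>f'\<close> at \<open>x\<close> alone
controls up to \<open>o(t)\<close>; the mean value inequality then gives an error \<open>o(t\<^sup>2)\<close>.\<close>

lemma second_difference_approx:
  fixes f :: "'a::real_normed_vector \<Rightarrow> 'b::real_normed_vector" and f' :: "'a \<Rightarrow> 'a \<Rightarrow>\<^sub>L 'b"
  assumes S: "open S" "x \<in> S"
    and f': "\<And>y. y \<in> S \<Longrightarrow> (f has_derivative blinfun_apply (f' y)) (at y)"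
    and f'': "(f' has_derivative f'') (at x)"
    and e: "e > 0"
  shows "\<forall>\<^sub>F t in at_right 0.
    norm (f (x + t *\<^sub>R u + t *\<^sub>R v) - f (x + t *\<^sub>R u) - f (x + t *\<^sub>R v) + f x - t\<^sup>2 *\<^sub>R f'' u v)
      \<le> e * t\<^sup>2"
proof -
  \<comment> \<open>This factor bounds what the two increments contribute to the error; adding 1 keeps it positive.\<close>
  define C where "C = (norm u + 2 * norm v) * norm v + 1"
  have C: "C > 0" unfolding C_def by (smt (verit) norm_ge_zero mult_nonneg_nonneg)
  have lin: "linear f''" using f'' has_derivative_linear by blast
  obtain d1 where d1: "d1 > 0" "ball x d1 \<subseteq> S" using S openE by blast
  obtain d2 where d2: "d2 > 0"
    "\<And>y. norm (y - x) < d2 \<Longrightarrow> norm (f' y - f' x - f'' (y - x)) \<le> e / C * norm (y - x)"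
    using f'' e C unfolding has_derivative_at_alt by (meson divide_pos_pos)
  define d where "d = min d1 d2 / (norm u + norm v + 1)"
  have den: "norm u + norm v + 1 > 0" by (smt (verit) norm_ge_zero)
  have d: "d > 0" using d1 d2 den by (simp add: d_def)
  have "norm (f (x + t *\<^sub>R u + t *\<^sub>R v) - f (x + t *\<^sub>R u) - f (x + t *\<^sub>R v) + f x - t\<^sup>2 *\<^sub>R f'' u v)
      \<le> e * t\<^sup>2" if t: "0 < t" "t < d" for t
  proof -
    have small: "norm (a *\<^sub>R u + r *\<^sub>R v) < min d1 d2" if "a \<in> {0..t}" "r \<in> {0..t}" for a r
    proof -
      have "norm (a *\<^sub>R u + r *\<^sub>R v) \<le> a * norm u + r * norm v"
        using that by (metis abs_of_nonneg atLeastAtMost_iff norm_scaleR norm_triangle_ineq)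
      also have "\<dots> \<le> t * norm u + t * norm v"
        using that by (intro add_mono mult_right_mono) auto
      also have "\<dots> \<le> t * (norm u + norm v + 1)" using t by (simp add: algebra_simps)
      also have "\<dots> < min d1 d2" using t den by (simp add: d_def pos_less_divide_eq)
      finally show ?thesis .
    qed
    have inS: "x + (a *\<^sub>R u + r *\<^sub>R v) \<in> S" if "a \<in> {0..t}" "r \<in> {0..t}" for a r
      using small[OF that] d1(2)
      by (metis add_diff_cancel_left' dist_commute dist_norm mem_ball min_less_iff_conj subsetD)
    define \<phi> where "\<phi> r = f (x + t *\<^sub>R u + r *\<^sub>R v) - f (x + r *\<^sub>R v) - (r * t) *\<^sub>R f'' u v" for r
    define \<phi>' where "\<phi>' r = f' (x + t *\<^sub>R u + r *\<^sub>R v) v - f' (x + r *\<^sub>R v) v - t *\<^sub>R f'' u v" for r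
    have "norm (\<phi> t - \<phi> 0) \<le> (e * t) * norm (t - 0)"
    proof (rule differentiable_bound[of "{0..t}"])
      fix r assume r: "r \<in> {0..t}"
      have i1: "x + t *\<^sub>R u + r *\<^sub>R v \<in> S" and i2: "x + r *\<^sub>R v \<in> S"
        using inS[of t r] inS[of 0 r] r t by (auto simp: add.assoc)
      have "((\<lambda>r. f (x + t *\<^sub>R u + r *\<^sub>R v)) has_derivative (\<lambda>h. f' (x + t *\<^sub>R u + r *\<^sub>R v) (h *\<^sub>R v)))
          (at r within {0..t})"
        using i1 by (intro has_derivative_compose[OF _ f'] derivative_eq_intros) auto
      moreover have "((\<lambda>r. f (x + r *\<^sub>R v)) has_derivative (\<lambda>h. f' (x + r *\<^sub>R v) (h *\<^sub>R v)))
          (at r within {0..t})"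
        using i2 by (intro has_derivative_compose[OF _ f'] derivative_eq_intros) auto
      ultimately show "(\<phi> has_derivative (\<lambda>h. h *\<^sub>R \<phi>' r)) (at r within {0..t})"
        unfolding \<phi>_def \<phi>'_def
        by (auto intro!: derivative_eq_intros simp: blinfun.scaleR_right algebra_simps)
      have "norm (\<phi>' r) \<le> e * t"
      proof -
        define R where "R y = f' y - f' x - f'' (y - x)" for y
        have R: "norm (R (x + w) v) \<le> e / C * norm w * norm v" if "norm w < d2" for w
          using norm_blinfun[of "R (x + w)" v] d2(2)[of "x + w"] that
            mult_right_mono[of "norm (R (x + w))" "e / C * norm w" "norm v"]
          by (auto simp: R_def)
        have "\<phi>' r = R (x + (t *\<^sub>R u + r *\<^sub>R v)) v - R (x + r *\<^sub>R v) v"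
          unfolding R_def \<phi>'_def using lin
          by (simp add: linear_add linear_cmul blinfun.diff_left blinfun.add_left blinfun.scaleR_left
              algebra_simps)
        also have "norm \<dots> \<le> e / C * norm (t *\<^sub>R u + r *\<^sub>R v) * norm v + e / C * norm (r *\<^sub>R v) * norm v"
          using small[of t r] small[of 0 r] r t
          by (intro norm_triangle_le_diff add_mono R) auto
        also have "\<dots> = e / C * ((norm (t *\<^sub>R u + r *\<^sub>R v) + norm (r *\<^sub>R v)) * norm v)"
          by (simp add: algebra_simps)
        also have "\<dots> \<le> e / C * (t * C)"
        proof (rule mult_left_mono)
          have "norm (t *\<^sub>R u + r *\<^sub>R v) \<le> t * norm u + r * norm v"
            using r t by (metis abs_of_nonneg atLeastAtMost_iff less_imp_le norm_scaleR norm_triangle_ineq)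
          moreover have "r * norm v \<le> t * norm v" using r by (simp add: mult_right_mono)
          ultimately have "norm (t *\<^sub>R u + r *\<^sub>R v) + norm (r *\<^sub>R v) \<le> t * (norm u + 2 * norm v)"
            using r by (simp add: algebra_simps)
          then have "(norm (t *\<^sub>R u + r *\<^sub>R v) + norm (r *\<^sub>R v)) * norm v
              \<le> t * (norm u + 2 * norm v) * norm v" by (rule mult_right_mono) simp
          also have "\<dots> \<le> t * C" using t by (simp add: C_def algebra_simps)
          finally show "(norm (t *\<^sub>R u + r *\<^sub>R v) + norm (r *\<^sub>R v)) * norm v \<le> t * C" .
        qed (use e C in auto)
        also have "\<dots> = e * t" using C by simp
        finally show ?thesis .
      qed
      then show "onorm (\<lambda>h. h *\<^sub>R \<phi>' r) \<le> e * t"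
        by (intro onorm_le) (simp add: mult.commute mult_left_mono)
    qed (use t in auto)
    moreover have "\<phi> t - \<phi> 0 = f (x + t *\<^sub>R u + t *\<^sub>R v) - f (x + t *\<^sub>R u) - f (x + t *\<^sub>R v) + f x - t\<^sup>2 *\<^sub>R f'' u v"
      by (simp add: \<phi>_def power2_eq_square)
    ultimately show ?thesis using t by (simp add: power2_eq_square mult.assoc)
  qed
  then show ?thesis using d unfolding eventually_at_right_field by auto
qed

text \<open>The second difference is symmetric in \<open>u\<close> and \<open>v\<close>, hence so is its leading coefficient.\<close>

lemma second_derivative_symmetric:
  fixes f :: "'a::real_normed_vector \<Rightarrow> 'b::real_normed_vector" and f' :: "'a \<Rightarrow> 'a \<Rightarrow>\<^sub>L 'b"
  assumes S: "open S" "x \<in> S"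
    and f': "\<And>y. y \<in> S \<Longrightarrow> (f has_derivative blinfun_apply (f' y)) (at y)"
    and f'': "(f' has_derivative f'') (at x)"
  shows "f'' u v = f'' v u"
proof (rule ccontr)
  assume "f'' u v \<noteq> f'' v u"
  then have e: "norm (f'' u v - f'' v u) / 3 > 0" (is "?e > 0") by simp
  have approx: "\<forall>\<^sub>F t in at_right 0.
      norm (f (x + t *\<^sub>R p + t *\<^sub>R q) - f (x + t *\<^sub>R p) - f (x + t *\<^sub>R q) + f x - t\<^sup>2 *\<^sub>R f'' p q)
        \<le> ?e * t\<^sup>2" for p q
    using S f' f'' e by (rule second_difference_approx)
  have "\<forall>\<^sub>F t::real in at_right 0. t > 0" by (simp add: eventually_at_right_less)
  then have "\<forall>\<^sub>F t::real in at_right 0. False"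
    using approx[of u v] approx[of v u]
  proof eventually_elim
    case (elim t)
    let ?D = "f (x + t *\<^sub>R u + t *\<^sub>R v) - f (x + t *\<^sub>R u) - f (x + t *\<^sub>R v) + f x"
    have "f (x + t *\<^sub>R v + t *\<^sub>R u) - f (x + t *\<^sub>R v) - f (x + t *\<^sub>R u) + f x = ?D"
      by (simp add: algebra_simps)
    then have "norm (?D - t\<^sup>2 *\<^sub>R f'' v u) \<le> ?e * t\<^sup>2" using elim(3) by (simp only:)
    then have "norm ((?D - t\<^sup>2 *\<^sub>R f'' v u) - (?D - t\<^sup>2 *\<^sub>R f'' u v)) \<le> ?e * t\<^sup>2 + ?e * t\<^sup>2"
      using elim(2) by (rule order_trans[OF norm_triangle_ineq4 add_mono])
    moreover have "(?D - t\<^sup>2 *\<^sub>R f'' v u) - (?D - t\<^sup>2 *\<^sub>R f'' u v) = t\<^sup>2 *\<^sub>R (f'' u v - f'' v u)"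
      by (simp add: algebra_simps)
    ultimately have "t\<^sup>2 * norm (f'' u v - f'' v u) \<le> 2 * ?e * t\<^sup>2" by simp
    then have "norm (f'' u v - f'' v u) \<le> 2 * ?e" using elim(1) by simp
    then show False using e by linarith
  qed
  then show False by simp
qed

section \<open>Linear differential equations on short intervals\<close>

text \<open>Uniqueness for linear equations. By the mean value inequality the maximum of \<open>norm y\<close> on the interval
is at most \<open>L * (u - l)\<close> times itself, so on a short interval it is zero.\<close>

lemma zero_of_derivative_bound:
  fixes y :: "real \<Rightarrow> 'b::real_normed_vector"
  assumes y': "\<And>t. t \<in> {l..u} \<Longrightarrow> (y has_vector_derivative y' t) (at t within {l..u})"
    and bound: "\<And>t. t \<in> {l..u} \<Longrightarrow> norm (y' t) \<le> L * norm (y t)"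
    and x: "x \<in> {l..u}" "y x = 0"
    and L: "0 \<le> L" "L * (u - l) < 1"
    and t: "t \<in> {l..u}"
  shows "y t = 0"
proof -
  have "continuous_on {l..u} (\<lambda>t. norm (y t))"
    using y' by (intro continuous_on_norm) (metis continuous_on_vector_derivative)
  then obtain m where m: "m \<in> {l..u}" "\<And>t. t \<in> {l..u} \<Longrightarrow> norm (y t) \<le> norm (y m)"
    using continuous_attains_sup[of "{l..u}" "\<lambda>t. norm (y t)"] x by auto
  have "norm (y m - y x) \<le> (L * norm (y m)) * norm (m - x)"
  proof (rule differentiable_bound[of "{l..u}"])
    fix t assume t: "t \<in> {l..u}"
    show "(y has_derivative (\<lambda>h. h *\<^sub>R y' t)) (at t within {l..u})"
      using y'[OF t] by (simp add: has_vector_derivative_def)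
    have "norm (y' t) \<le> L * norm (y m)"
      using bound[OF t] m(2)[OF t] L(1) by (meson mult_left_mono order_trans)
    then have "norm (h *\<^sub>R y' t) \<le> L * norm (y m) * norm h" for h
      by (simp add: mult.commute mult_left_mono)
    then show "onorm (\<lambda>h. h *\<^sub>R y' t) \<le> L * norm (y m)" by (rule onorm_le)
  qed (use m x in auto)
  also have "\<dots> \<le> (L * norm (y m)) * (u - l)"
    using m(1) x(1) L(1) by (intro mult_left_mono) (auto simp: abs_le_iff)
  finally have "norm (y m) * (1 - L * (u - l)) \<le> 0" using x(2) by (simp add: algebra_simps)
  then have "norm (y m) \<le> 0" using L(2) by (simp add: mult_le_0_iff)
  then show ?thesis using m(2)[OF t] by simp
qed

text \<open>On an interval so short that \<open>K * (u - l) \<le> 1 / 2\<close> the integral operator of the equation is a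
contraction of the space of bounded continuous functions. To stay within functions on the whole
line, its values are continued by constants outside \<open>[l, u]\<close>.\<close>

lemma linear_ODE_local:
  fixes b :: "real \<Rightarrow> 'e::banach \<Rightarrow>\<^sub>L 'e"
  assumes b: "continuous_on {l..u} b" and K: "\<And>t. t \<in> {l..u} \<Longrightarrow> norm (b t) \<le> K"
    and len: "K * (u - l) \<le> 1 / 2" and x: "x \<in> {l..u}"
  shows "\<exists>y. y x = v \<and> (\<forall>t\<in>{l..u}. (y has_vector_derivative b t (y t)) (at t within {l..u}))"
proof -
  define Q where "Q f t = integral {l..t} (\<lambda>s. b s (f s))" for f :: "real \<Rightarrow> 'e" and t
  have K0: "0 \<le> K" using K[OF x] norm_ge_zero order_trans by blast
  have Q: "(Q f has_vector_derivative b t (f t)) (at t within {l..u})"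
    if "continuous_on {l..u} f" "t \<in> {l..u}" for f t
    unfolding Q_def[abs_def] using that b
    by (intro integral_has_vector_derivative blinfun.continuous_on) auto
  have "\<exists>g::real \<Rightarrow>\<^sub>C 'e. \<forall>t. g t = v + Q f (clamp l u t) - Q f x" for f :: "real \<Rightarrow>\<^sub>C 'e"
  proof -
    have "continuous_on {l..u} (Q f)"
      using Q[of f] by (intro continuous_on_vector_derivative[where f'="\<lambda>t. b t (f t)"]) auto
    then have "continuous_on (cbox l u) (\<lambda>t. v + Q f t - Q f x)"
      by (auto intro!: continuous_intros)
    then obtain g :: "real \<Rightarrow>\<^sub>C 'e" where "\<And>t. g t = v + Q f (clamp l u t) - Q f x"
      by (rule continuous_on_cbox_bcontfunE) blast
    then show ?thesis by blast
  qed
  then obtain T :: "(real \<Rightarrow>\<^sub>C 'e) \<Rightarrow> (real \<Rightarrow>\<^sub>C 'e)"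
    where "\<forall>f t. T f t = v + Q f (clamp l u t) - Q f x" using choice by (metis (no_types, lifting))
  then have T: "\<And>f t. T f t = v + Q f (clamp l u t) - Q f x" by blast
  have "dist (T f) (T g) \<le> 1 / 2 * dist f g" for f g
  proof (rule dist_bound)
    fix t
    define s where "s = clamp l u t"
    have s: "s \<in> {l..u}" using x clamp_in_interval[of l u t] by (simp add: s_def)
    have "norm ((Q f s - Q g s) - (Q f x - Q g x)) \<le> (K * dist f g) * norm (s - x)"
    proof (rule differentiable_bound[of "{l..u}"])
      fix r assume r: "r \<in> {l..u}"
      have "((\<lambda>t. Q f t - Q g t) has_vector_derivative (b r (f r) - b r (g r))) (at r within {l..u})"
        using r by (intro derivative_intros Q) auto
      then show "((\<lambda>t. Q f t - Q g t) has_derivative (\<lambda>h. h *\<^sub>R b r (f r - g r))) (at r within {l..u})"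
        by (simp add: has_vector_derivative_def blinfun.diff_right)
      have "norm (b r (f r - g r)) \<le> norm (b r) * norm (f r - g r)" by (rule norm_blinfun)
      also have "\<dots> \<le> K * dist f g"
        using K[OF r] dist_bounded[of f r g] K0 by (intro mult_mono) (auto simp: dist_norm)
      finally show "onorm (\<lambda>h. h *\<^sub>R b r (f r - g r)) \<le> K * dist f g"
        by (intro onorm_le) (simp add: mult.commute mult_left_mono)
    qed (use s x in auto)
    also have "\<dots> \<le> (K * dist f g) * (u - l)"
      using s x K0 by (intro mult_left_mono) (auto simp: abs_le_iff)
    also have "\<dots> = (K * (u - l)) * dist f g" by simp
    also have "\<dots> \<le> 1 / 2 * dist f g" using len by (intro mult_right_mono) auto
    finally show "dist (T f t) (T g t) \<le> 1 / 2 * dist f g"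
      by (simp add: T s_def dist_norm algebra_simps)
  qed
  then have "\<exists>!f. T f = f" by (intro banach_fix_type[of "1/2"]) auto
  then obtain f where f: "T f = f" by blast
  have f_eq: "f t = v + Q f t - Q f x" if "t \<in> {l..u}" for t
    using T[of f t] that by (simp add: f)
  have "(f has_vector_derivative b t (f t)) (at t within {l..u})" if t: "t \<in> {l..u}" for t
  proof (rule has_vector_derivative_transform[OF t f_eq])
    show "((\<lambda>t. v + Q f t - Q f x) has_vector_derivative b t (f t)) (at t within {l..u})"
      using Q[of f t] t by (auto intro!: derivative_eq_intros)
  qed
  moreover have "f x = v" using f_eq[OF x] by simp
  ultimately show ?thesis by blast
qed

section \<open>Calculus of C1 maps\<close>

lemma C1_onI:
  assumes "\<And>x. x \<in> S \<Longrightarrow> (f has_derivative blinfun_apply (f' x)) (at x)" "continuous_on S f'"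
  shows "C1_on S f"
  using assms unfolding C1_on_def by blast

lemma C1_on_subset: "C1_on S f \<Longrightarrow> T \<subseteq> S \<Longrightarrow> C1_on T f"
  unfolding C1_on_def by (meson continuous_on_subset subsetD)

lemma C1_on_imp_continuous_on: "C1_on S f \<Longrightarrow> continuous_on S f"
  unfolding C1_on_def
  by (meson continuous_at_imp_continuous_on has_derivative_continuous)

lemma C2_on_imp_C1_on: "C2_on S f \<Longrightarrow> C1_on S f"
  unfolding C2_on_def C1_on_def[of S f] using C1_on_imp_continuous_on by blast

lemma C1_on_cong:
  assumes f: "C1_on S f" and S: "open S" and eq: "\<And>x. x \<in> S \<Longrightarrow> f x = g x"
  shows "C1_on S g"
proof -
  obtain f' where f': "\<And>x. x \<in> S \<Longrightarrow> (f has_derivative blinfun_apply (f' x)) (at x)"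
    "continuous_on S f'" using f unfolding C1_on_def by blast
  have "(g has_derivative blinfun_apply (f' x)) (at x)" if "x \<in> S" for x
    using has_derivative_transform_within_open[OF f'(1)[OF that] S that] eq by blast
  then show ?thesis using f'(2) by (rule C1_onI)
qed

text \<open>The derivatives found near the single points fit together because derivatives at a point of an open
set are unique.\<close>

lemma C1_on_local:
  assumes "\<And>x. x \<in> S \<Longrightarrow> \<exists>N. open N \<and> x \<in> N \<and> C1_on N f"
  shows "C1_on S f"
proof (rule C1_onI)
  define f' where "f' x = Blinfun (frechet_derivative f (at x))" for x
  have loc: "(f has_derivative blinfun_apply (f' x)) (at x) \<and> isCont f' x" if x: "x \<in> S" for x
  proof -
    obtain N g where N: "open N" "x \<in> N"
      and g: "\<And>y. y \<in> N \<Longrightarrow> (f has_derivative blinfun_apply (g y)) (at y)" "continuous_on N g"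
      using assms[OF x] unfolding C1_on_def by blast
    have "f' y = g y" if "y \<in> N" for y
      unfolding f'_def using frechet_derivative_at[OF g(1)[OF that]] blinfun_apply_inverse by metis
    then have "continuous_on N f'" "f' x = g x" using g(2) N(2) by auto
    then show ?thesis using N g(1) continuous_on_eq_continuous_at by metis
  qed
  show "(f has_derivative blinfun_apply (f' x)) (at x)" if "x \<in> S" for x using loc[OF that] by blast
  show "continuous_on S f'" using loc continuous_at_imp_continuous_on by blast
qed

lemma C1_on_const: "C1_on S (\<lambda>x. k)"
  by (rule C1_onI[where f'="\<lambda>_. 0"]) (auto simp: zero_blinfun.rep_eq)

lemma C1_on_bounded_linear: "bounded_linear f \<Longrightarrow> C1_on S f"
  by (rule C1_onI[where f'="\<lambda>_. Blinfun f"])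
     (auto simp: bounded_linear_Blinfun_apply bounded_linear_imp_has_derivative)

lemma C1_on_compose:
  assumes f: "C1_on S f" and g: "C1_on T g" and im: "f ` S \<subseteq> T"
  shows "C1_on S (\<lambda>x. g (f x))"
proof -
  obtain f' where f': "\<And>x. x \<in> S \<Longrightarrow> (f has_derivative blinfun_apply (f' x)) (at x)"
    "continuous_on S f'" using f unfolding C1_on_def by blast
  obtain g' where g': "\<And>x. x \<in> T \<Longrightarrow> (g has_derivative blinfun_apply (g' x)) (at x)"
    "continuous_on T g'" using g unfolding C1_on_def by blast
  show ?thesis
  proof (rule C1_onI)
    fix x assume "x \<in> S"
    then have "((\<lambda>x. g (f x)) has_derivative (\<lambda>h. g' (f x) (f' x h))) (at x)"
      using im by (intro has_derivative_compose[OF f'(1) g'(1)]) auto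
    then show "((\<lambda>x. g (f x)) has_derivative blinfun_apply (g' (f x) o\<^sub>L f' x)) (at x)"
      by (simp add: blinfun_compose.rep_eq o_def)
  next
    have "continuous_on S (\<lambda>x. g' (f x))"
      using continuous_on_compose2[OF g'(2) C1_on_imp_continuous_on[OF f] im] .
    then show "continuous_on S (\<lambda>x. g' (f x) o\<^sub>L f' x)"
      by (intro bounded_bilinear.continuous_on[OF bounded_bilinear_blinfun_compose] f'(2))
  qed
qed

lemma C1_on_bounded_linear_compose:
  "bounded_linear g \<Longrightarrow> C1_on S f \<Longrightarrow> C1_on S (\<lambda>x. g (f x))"
  by (rule C1_on_compose[where T=UNIV]) (auto intro: C1_on_bounded_linear)

lemma C1_on_add:
  assumes "C1_on S f" "C1_on S g"
  shows "C1_on S (\<lambda>x. f x + g x)"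
proof -
  obtain f' where f': "\<And>x. x \<in> S \<Longrightarrow> (f has_derivative blinfun_apply (f' x)) (at x)"
    "continuous_on S f'" using assms(1) unfolding C1_on_def by blast
  obtain g' where g': "\<And>x. x \<in> S \<Longrightarrow> (g has_derivative blinfun_apply (g' x)) (at x)"
    "continuous_on S g'" using assms(2) unfolding C1_on_def by blast
  show ?thesis
    by (rule C1_onI[where f'="\<lambda>x. f' x + g' x"])
       (auto intro!: derivative_eq_intros continuous_intros f' g' simp: blinfun.add_left)
qed

lemma C1_on_sum: "(\<And>i. i \<in> I \<Longrightarrow> C1_on S (f i)) \<Longrightarrow> C1_on S (\<lambda>x. \<Sum>i\<in>I. f i x)"
  by (induction I rule: infinite_finite_induct) (auto intro: C1_on_add C1_on_const)

lemma C1_on_bounded_bilinear: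
  assumes P: "bounded_bilinear P" and "C1_on S f" "C1_on S g"
  shows "C1_on S (\<lambda>x. P (f x) (g x))"
proof -
  interpret bounded_bilinear P by fact
  obtain f' where f': "\<And>x. x \<in> S \<Longrightarrow> (f has_derivative blinfun_apply (f' x)) (at x)"
    "continuous_on S f'" using assms(2) unfolding C1_on_def by blast
  obtain g' where g': "\<And>x. x \<in> S \<Longrightarrow> (g has_derivative blinfun_apply (g' x)) (at x)"
    "continuous_on S g'" using assms(3) unfolding C1_on_def by blast
  have c: "continuous_on S f" "continuous_on S g" using assms C1_on_imp_continuous_on by auto
  define D where "D x = (prod_left (g x) o\<^sub>L f' x) + (prod_right (f x) o\<^sub>L g' x)" for x
  have D: "blinfun_apply (D x) h = P (f' x h) (g x) + P (f x) (g' x h)" for x h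
    by (simp add: D_def blinfun.add_left prod_left.rep_eq prod_right.rep_eq)
  show ?thesis
  proof (rule C1_onI)
    fix x assume "x \<in> S"
    then show "((\<lambda>x. P (f x) (g x)) has_derivative blinfun_apply (D x)) (at x)"
      using FDERIV[OF f'(1) g'(1)] by (simp add: D[abs_def] add.commute)
  next
    show "continuous_on S D"
      unfolding D_def
      by (intro continuous_on_add bounded_bilinear.continuous_on[OF bounded_bilinear_blinfun_compose]
          bounded_linear.continuous_on[OF bounded_linear_prod_left]
          bounded_linear.continuous_on[OF bounded_linear_prod_right] f' g' c)
  qed
qed

lemma C1_on_diff:
  assumes "C1_on S f" "C1_on S g" shows "C1_on S (\<lambda>x. f x - g x)"
  using C1_on_add[OF assms(1) C1_on_bounded_linear_compose[OF bounded_linear_minus[OF bounded_linear_ident] assms(2)]]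
  by simp

lemmas C1_on_scaleR = C1_on_bounded_bilinear[OF bounded_bilinear_scaleR]
lemmas C1_on_inner = C1_on_bounded_bilinear[OF bounded_bilinear_inner]

lemma C1_on_vec_nth: "C1_on S f \<Longrightarrow> C1_on S (\<lambda>x. f x $ i)"
  by (rule C1_on_bounded_linear_compose[OF bounded_linear_vec_nth])

lemma bounded_bilinear_matrix_mul: "bounded_bilinear ((**) :: real^'n^'m \<Rightarrow> real^'k^'n \<Rightarrow> real^'k^'m)"
  unfolding bilinear_conv_bounded_bilinear[symmetric] bilinear_def
  by (auto intro!: linearI simp: matrix_add_ldistrib vec_eq_iff matrix_matrix_mult_def
      algebra_simps sum.distrib sum_distrib_left)

lemmas C1_on_matrix_mul = C1_on_bounded_bilinear[OF bounded_bilinear_matrix_mul]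

lemma C1_on_prod:
  fixes f :: "'i \<Rightarrow> 'a::real_normed_vector \<Rightarrow> real"
  shows "(\<And>i. i \<in> I \<Longrightarrow> C1_on S (f i)) \<Longrightarrow> C1_on S (\<lambda>x. \<Prod>i\<in>I. f i x)"
  by (induction I rule: infinite_finite_induct)
     (auto intro: C1_on_bounded_bilinear[OF bounded_bilinear_mult] C1_on_const)

lemma C1_on_real:
  fixes f :: "real \<Rightarrow> 'b::real_normed_vector"
  assumes "\<And>x. x \<in> S \<Longrightarrow> (f has_vector_derivative f' x) (at x)" "continuous_on S f'"
  shows "C1_on S f"
proof (rule C1_onI)
  show "(f has_derivative blinfun_apply (blinfun_scaleR_left (f' x))) (at x)" if "x \<in> S" for x
    using assms(1)[OF that] by (simp add: has_vector_derivative_def)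
  show "continuous_on S (\<lambda>x. blinfun_scaleR_left (f' x))"
    using assms(2) by (intro bounded_linear.continuous_on[OF bounded_linear_blinfun_scaleR_left])
qed

lemma C1_on_frechet_derivative_continuous:
  assumes "C1_on S f"
  shows "continuous_on S (\<lambda>x. frechet_derivative f (at x) v)"
proof -
  obtain f' where f': "\<And>x. x \<in> S \<Longrightarrow> (f has_derivative blinfun_apply (f' x)) (at x)"
    "continuous_on S f'" using assms unfolding C1_on_def by blast
  have "continuous_on S (\<lambda>x. f' x v)" using f'(2) by (intro continuous_intros)
  moreover have "f' x v = frechet_derivative f (at x) v" if "x \<in> S" for x
    using frechet_derivative_at[OF f'(1)[OF that]] by metis
  ultimately show ?thesis by (simp cong: continuous_on_cong)
qed

section \<open>Cutoff functions and extensions of curves\<close>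

text \<open>A building block of cutoff functions.\<close>

lemma C1_on_max_0_squared: "C1_on S (\<lambda>x::real. (max 0 x)\<^sup>2)"
proof (rule C1_on_real)
  fix x :: real
  have "((\<lambda>x::real. if x \<in> {..0} then 0 else x\<^sup>2) has_vector_derivative
      (if x \<in> {..0} then 0 else 2 * x)) (at x within UNIV)"
    by (rule has_vector_derivative_If_within_closures[where T="{0..}" and f'="\<lambda>_. 0" and g'="\<lambda>x. 2 * x"])
       (auto intro!: derivative_eq_intros simp: has_real_derivative_iff_has_vector_derivative[symmetric])
  moreover have "(\<lambda>x::real. if x \<in> {..0} then 0 else x\<^sup>2) = (\<lambda>x. (max 0 x)\<^sup>2)" by auto
  ultimately show "((\<lambda>x. (max 0 x)\<^sup>2) has_vector_derivative 2 * max 0 x) (at x)"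
    by (auto simp: max_def split: if_splits)
qed (intro continuous_intros)

text \<open>With \<open>s x = (max 0 x)\<^sup>2\<close>, the function \<open>s (1 - s (q - 1))\<close> is 1 for \<open>q \<le> 1\<close> and 0 for \<open>q \<ge> 2\<close>; it is
used with \<open>q\<close> the squared distance divided by \<open>r\<^sup>2\<close>.\<close>

lemma C1_bump:
  fixes x0 :: "'a::real_inner"
  assumes r: "0 < r"
  obtains \<beta> :: "'a \<Rightarrow> real" where "C1_on UNIV \<beta>"
    "\<And>x. dist x x0 \<le> r \<Longrightarrow> \<beta> x = 1" "\<And>x. dist x x0 \<ge> 2 * r \<Longrightarrow> \<beta> x = 0"
proof
  let ?s = "\<lambda>x::real. (max 0 x)\<^sup>2"
  define q where "q x = (1 / r\<^sup>2) * ((x - x0) \<bullet> (x - x0))" for x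
  define \<beta> where "\<beta> x = ?s (1 + (-1) * ?s (- 1 + q x))" for x
  have q: "q x = (dist x x0 / r)\<^sup>2" for x
    by (simp add: q_def dist_norm power2_norm_eq_inner[symmetric] power_divide)
  have "C1_on UNIV (\<lambda>x::'a. x - x0)"
    using C1_on_add[OF C1_on_bounded_linear[OF bounded_linear_ident] C1_on_const[of UNIV "- x0"]] by simp
  then have "C1_on UNIV q" unfolding q_def
    by (intro C1_on_bounded_linear_compose[OF bounded_linear_mult_right] C1_on_inner)
  then show "C1_on UNIV \<beta>" unfolding \<beta>_def
    by (intro C1_on_compose[OF _ C1_on_max_0_squared[of UNIV]] C1_on_add C1_on_const
        C1_on_bounded_linear_compose[OF bounded_linear_mult_right]) auto
  show "\<beta> x = 1" if "dist x x0 \<le> r" for x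
  proof -
    have "q x \<le> 1" using that r by (simp add: q power_le_one)
    then show ?thesis by (simp add: \<beta>_def max_def)
  qed
  show "\<beta> x = 0" if "dist x x0 \<ge> 2 * r" for x
  proof -
    have "2 \<le> dist x x0 / r" using that r by (simp add: field_simps)
    then have "2\<^sup>2 \<le> q x" unfolding q by (intro power_mono) auto
    then have "1 \<le> ?s (- 1 + q x)" by (simp add: max_def)
    then show ?thesis by (simp add: \<beta>_def max_def)
  qed
qed

text \<open>A curve that is C1 up to the end points of its interval is continued beyond them by integrating its
derivative, which is continued by constants.\<close>

lemma C1_extension_real:
  fixes y :: "real \<Rightarrow> 'b::banach"
  assumes lu: "l \<le> u"
    and y: "\<And>t. t \<in> {l..u} \<Longrightarrow> (y has_vector_derivative y' t) (at t within {l..u})"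
    and y': "continuous_on {l..u} y'"
  obtains z z' where "\<And>t. t \<in> {l..u} \<Longrightarrow> z t = y t" "\<And>t. t \<in> {l..u} \<Longrightarrow> z' t = y' t"
    "continuous_on {l-1<..<u+1} z'"
    "\<And>t. t \<in> {l-1<..<u+1} \<Longrightarrow> (z has_vector_derivative z' t) (at t)"
proof -
  define z' where "z' t = y' (clamp l u t)" for t
  have z'_eq: "z' t = y' t" if "t \<in> {l..u}" for t using that by (simp add: z'_def)
  have cont: "continuous_on S z'" for S
    unfolding z'_def using y' by (intro clamp_continuous_on) simp
  obtain g where g: "\<And>t. t \<in> {l-1..u+1} \<Longrightarrow> (g has_vector_derivative z' t) (at t within {l-1..u+1})"
    using antiderivative_continuous[OF cont] by blast
  define z where "z t = g t + (y l - g l)" for t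
  have diff: "y t - g t = y l - g l" if "t \<in> {l..u}" for t
  proof -
    have "((\<lambda>t. y t - g t) has_vector_derivative 0) (at t within {l..u})" if "t \<in> {l..u}" for t
    proof -
      have "(g has_vector_derivative z' t) (at t within {l..u})"
        using that by (intro has_vector_derivative_within_subset[OF g]) auto
      then have "((\<lambda>t. y t - g t) has_vector_derivative y' t - z' t) (at t within {l..u})"
        by (intro has_vector_derivative_diff y that)
      then show ?thesis using z'_eq[OF that] by simp
    qed
    then obtain k where "\<And>t. t \<in> {l..u} \<Longrightarrow> y t - g t = k"
      using has_vector_derivative_zero_constant[of "{l..u}" "\<lambda>t. y t - g t"] by auto
    then show ?thesis using that lu by auto
  qed
  show ?thesis
  proof (rule that[of z z'])
    show "z t = y t" if "t \<in> {l..u}" for t using diff[OF that] by (simp add: z_def algebra_simps)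
    show "(z has_vector_derivative z' t) (at t)" if "t \<in> {l-1<..<u+1}" for t
    proof -
      have "(g has_vector_derivative z' t) (at t within {l-1<..<u+1})"
        using that by (intro has_vector_derivative_within_subset[OF g]) auto
      then have "(g has_vector_derivative z' t) (at t)"
        by (simp only: at_within_open[OF that open_greaterThanLessThan])
      then show ?thesis unfolding z_def[abs_def] by (simp add: has_vector_derivative_add_const)
    qed
  qed (use z'_eq cont in auto)
qed

text \<open>Where \<open>x' \<noteq> 0\<close>, the parameter is locally a C1 function of \<open>x\<close>, and so is every C1 curve \<open>y\<close>. The
point \<open>s\<close> may be an end point of the interval; both curves are first continued beyond it, so that
the inverse function theorem applies.\<close>

lemma C1_function_of_monotone_coordinate:
  fixes y :: "real \<Rightarrow> 'b::banach" and x :: "real \<Rightarrow> real"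
  assumes s: "s \<in> {l..u}"
    and x: "\<And>t. t \<in> {l..u} \<Longrightarrow> (x has_vector_derivative x' t) (at t within {l..u})"
    and x': "continuous_on {l..u} x'" and ne: "x' s \<noteq> 0"
    and y: "\<And>t. t \<in> {l..u} \<Longrightarrow> (y has_vector_derivative y' t) (at t within {l..u})"
    and y': "continuous_on {l..u} y'"
  obtains \<delta> W G where "0 < \<delta>" "open W" "x s \<in> W" "C1_on W G"
    "\<And>t. t \<in> {l..u} \<Longrightarrow> dist t s < \<delta> \<Longrightarrow> x t \<in> W \<and> G (x t) = y t"
proof -
  have lu: "l \<le> u" using s by simp
  let ?I = "{l-1<..<u+1}"
  obtain \<xi> \<xi>' where \<xi>: "\<And>t. t \<in> {l..u} \<Longrightarrow> \<xi> t = x t" "\<And>t. t \<in> {l..u} \<Longrightarrow> \<xi>' t = x' t"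
    "continuous_on ?I \<xi>'" "\<And>t. t \<in> ?I \<Longrightarrow> (\<xi> has_vector_derivative \<xi>' t) (at t)"
    using C1_extension_real[of l u x x', OF lu x x'] by blast
  obtain \<eta> \<eta>' where \<eta>: "\<And>t. t \<in> {l..u} \<Longrightarrow> \<eta> t = y t" "\<And>t. t \<in> {l..u} \<Longrightarrow> \<eta>' t = y' t"
    "continuous_on ?I \<eta>'" "\<And>t. t \<in> ?I \<Longrightarrow> (\<eta> has_vector_derivative \<eta>' t) (at t)"
    using C1_extension_real[of l u y y', OF lu y y'] by blast
  have sI: "s \<in> ?I" using s by auto
  define D where "D t = (blinfun_scaleR_left (\<xi>' t) :: real \<Rightarrow>\<^sub>L real)" for t
  have D: "(\<xi> has_derivative blinfun_apply (D t)) (at t)" if "t \<in> ?I" for t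
    using \<xi>(4)[OF that] by (simp add: D_def has_vector_derivative_def)
  have Dc: "continuous_on ?I D" unfolding D_def
    by (intro bounded_linear.continuous_on[OF bounded_linear_blinfun_scaleR_left] \<xi>(3))
  have inv: "blinfun_scaleR_left (inverse (\<xi>' s)) o\<^sub>L D s = id_blinfun"
    using ne \<xi>(2)[OF s] by (intro blinfun_eqI) (simp add: D_def)
  obtain N W g g' where N: "open N" "N \<subseteq> ?I" "s \<in> N" and W: "open W" "\<xi> s \<in> W"
    and hom: "homeomorphism N W \<xi> g"
    and g: "\<And>v. v \<in> W \<Longrightarrow> (g has_derivative (g' v)) (at v)"
      "\<And>v. v \<in> W \<Longrightarrow> g' v = inv (blinfun_apply (D (g v)))"
      "\<And>v. v \<in> W \<Longrightarrow> bij (blinfun_apply (D (g v)))"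
    using inverse_function_theorem[OF open_greaterThanLessThan D Dc sI inv] by blast
  have gN: "g v \<in> N" if "v \<in> W" for v using hom that by (auto simp: homeomorphism_def)
  have nz: "\<xi>' (g v) \<noteq> 0" if "v \<in> W" for v
  proof
    assume "\<xi>' (g v) = 0"
    then have "blinfun_apply (D (g v)) 0 = blinfun_apply (D (g v)) 1" by (simp add: D_def)
    then show False using g(3)[OF that] by (metis bij_def injD zero_neq_one)
  qed
  have g'_eq: "(g has_vector_derivative inverse (\<xi>' (g v))) (at v)" if "v \<in> W" for v
  proof -
    have "inv (blinfun_apply (D (g v))) = (\<lambda>h. h *\<^sub>R inverse (\<xi>' (g v)))"
      using nz[OF that] by (intro inv_equality) (auto simp: D_def)
    then show ?thesis using g(1,2)[OF that] by (simp add: has_vector_derivative_def)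
  qed
  have gc: "continuous_on W g" using hom by (simp add: homeomorphism_def)
  have "C1_on W (\<lambda>v. \<eta> (g v))"
  proof (rule C1_on_compose[where T="?I"])
    show "C1_on W g"
      using g'_eq continuous_on_compose2[OF \<xi>(3) gc] gN N(2) nz
      by (intro C1_on_real[where f'="\<lambda>v. inverse (\<xi>' (g v))"] continuous_on_inverse) auto
    show "C1_on ?I \<eta>" using \<eta>(3,4) by (intro C1_on_real) auto
    show "g ` W \<subseteq> ?I" using gN N(2) by auto
  qed
  moreover obtain \<delta> where \<delta>: "0 < \<delta>" "ball s \<delta> \<subseteq> N" using N(1,3) openE by blast
  moreover have "x t \<in> W \<and> \<eta> (g (x t)) = y t" if "t \<in> {l..u}" "dist t s < \<delta>" for t
  proof -
    have "t \<in> N" using \<delta>(2) that(2) by (auto simp: dist_commute)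
    then have "\<xi> t \<in> W" "g (\<xi> t) = t" using hom by (auto simp: homeomorphism_def)
    then show ?thesis using \<xi>(1) \<eta>(1) that(1) by simp
  qed
  ultimately show ?thesis using that[of \<delta> W "\<lambda>v. \<eta> (g v)"] W \<xi>(1)[OF s] by simp
qed

section \<open>Matrices and derivatives\<close>

lemma norm_vec_lambda_le:
  fixes f :: "'n::finite \<Rightarrow> 'b::real_normed_vector"
  shows "norm (\<chi> i. f i) \<le> (\<Sum>i\<in>UNIV. norm (f i))"
  unfolding norm_vec_def by (simp add: L2_set_le_sum)

lemma bounded_linear_vec_lambda:
  fixes f :: "'n::finite \<Rightarrow> 'a::real_normed_vector \<Rightarrow> 'b::real_normed_vector"
  assumes "\<And>i. bounded_linear (f i)"
  shows "bounded_linear (\<lambda>x. \<chi> i. f i x)"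
proof -
  interpret f: bounded_linear "f i" for i by fact
  have "\<forall>i. \<exists>K. \<forall>x. norm (f i x) \<le> norm x * K" using f.bounded by blast
  then obtain K where K: "\<And>i x. norm (f i x) \<le> norm x * K i" by metis
  show ?thesis
  proof (rule bounded_linear_intro[where K="\<Sum>i\<in>UNIV. K i"])
    fix x
    have "norm (\<chi> i. f i x) \<le> (\<Sum>i\<in>UNIV. norm (f i x))" by (rule norm_vec_lambda_le)
    also have "\<dots> \<le> (\<Sum>i\<in>UNIV. norm x * K i)" by (intro sum_mono K)
    finally show "norm (\<chi> i. f i x) \<le> norm x * (\<Sum>i\<in>UNIV. K i)" by (simp add: sum_distrib_left)
  qed (auto simp: vec_eq_iff f.add f.scaleR)
qed

lemma bounded_linear_matrix_of_blinfun:
  "bounded_linear (\<lambda>B::(real^'n) \<Rightarrow>\<^sub>L (real^'m). matrix (blinfun_apply B))"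
  unfolding matrix_def
  by (intro bounded_linear_vec_lambda bounded_linear_compose[OF bounded_linear_vec_nth]
      blinfun.bounded_linear_left)

lemma matrix_apply:
  fixes f :: "real^'n \<Rightarrow> real^'m"
  shows "linear f \<Longrightarrow> matrix f *v x = f x"
  by (metis matrix_vector_mul(2))

lemma matrix_blinfun_apply:
  fixes B :: "(real^'n) \<Rightarrow>\<^sub>L (real^'m)"
  shows "matrix (blinfun_apply B) *v x = blinfun_apply B x"
  by (intro matrix_apply bounded_linear.linear blinfun.bounded_linear_right)

lemma has_vector_derivative_transform_eventually:
  assumes "(f has_vector_derivative f') (at x within S)"
    and "\<forall>\<^sub>F t in at x within S. f t = g t" "x \<in> S" "f x = g x"
  shows "(g has_vector_derivative f') (at x within S)"
  using assms unfolding has_vector_derivative_def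
  by (intro has_derivative_transform_eventually[of f _ x S g])

lemma continuous_on_det:
  fixes f :: "'a::topological_space \<Rightarrow> real^'n^'n"
  assumes "continuous_on S f"
  shows "continuous_on S (\<lambda>x. det (f x))"
  unfolding det_def by (intro continuous_intros assms)

section \<open>Tensors of low type in matrix form\<close>

lemma sum_singleton_lists:
  "(\<Sum>K | length K = 1. f K) = (\<Sum>k\<in>(UNIV::'n::finite set). f [k])"
proof -
  have eq: "{K::'n list. length K = 1} = range (\<lambda>k. [k])" by (auto simp: length_Suc_conv)
  show ?thesis unfolding eq by (subst sum.reindex) (auto simp: inj_on_def)
qed

text \<open>The tensors in use have at most two indices, and their coordinates in a chart are handled as vectors
and matrices. Changes of coordinates then are products with \<open>Jac\<close>, the matrix of \<^const>\<open>jac\<close>.\<close>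

definition Jac :: "('m, 'n::finite) chart \<Rightarrow> ('m, 'n) chart \<Rightarrow> 'm \<Rightarrow> real^'n^'n" where
  "Jac c d p = (\<chi> i k. jac c d p i k)"

definition vector_coords :: "('m, 'n::finite) tensor \<Rightarrow> ('m, 'n) chart \<Rightarrow> real^'n" where
  "vector_coords t c = (\<chi> i. t c [i] [])"

definition endo_matrix :: "('m, 'n::finite) tensor \<Rightarrow> ('m, 'n) chart \<Rightarrow> real^'n^'n" where
  "endo_matrix t c = (\<chi> i k. t c [i] [k])"

definition D_coords :: "('m \<Rightarrow> ('m, 'n::finite) tensor) \<Rightarrow> ('m, 'n) chart \<Rightarrow> 'm \<Rightarrow> real^'n^'n" where
  "D_coords X c p = (\<chi> i k. pd c k (\<lambda>q. X q c [i] []) p)"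

lemma all_singleton_lists: "(\<forall>K. length K = 1 \<longrightarrow> P K) \<longleftrightarrow> (\<forall>k. P [k])"
  by (auto simp: length_Suc_conv)

lemma tensor_at_1_0_iff:
  "tensor_at A 1 0 p t \<longleftrightarrow>
    (\<forall>c\<in>charts_at A p. \<forall>d\<in>charts_at A p. vector_coords t d = Jac c d p *v vector_coords t c)"
proof -
  have "(\<forall>I J. length I = 1 \<longrightarrow> length J = 0 \<longrightarrow>
        t d I J = (\<Sum>K | length K = 1. \<Sum>L | length L = 0.
          (\<Prod>a<1. jac c d p (I!a) (K!a)) * (\<Prod>b<0. jac d c p (L!b) (J!b)) * t c K L))
     \<longleftrightarrow> vector_coords t d = Jac c d p *v vector_coords t c" for c d
  proof -
    have "(\<Sum>K | length K = 1. \<Sum>L::'b list | length L = 0.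
          (\<Prod>a<1. jac c d p (I!a) (K!a)) * (\<Prod>b<0. jac d c p (L!b) (J!b)) * t c K L)
        = (\<Sum>k\<in>UNIV. jac c d p (I!0) k * t c [k] [])" for I J
      unfolding sum_singleton_lists by simp
    then show ?thesis
      by (simp only: all_simps(5,6)[symmetric] length_0_conv)
         (simp add: all_singleton_lists[unfolded One_nat_def] vec_eq_iff vector_coords_def Jac_def matrix_vector_mult_def)
  qed
  then show ?thesis unfolding tensor_at_def by (simp only:)
qed

lemma tensor_at_1_1_iff:
  "tensor_at A 1 1 p t \<longleftrightarrow>
    (\<forall>c\<in>charts_at A p. \<forall>d\<in>charts_at A p.
      endo_matrix t d = Jac c d p ** endo_matrix t c ** Jac d c p)"
proof -
  have "(\<forall>I J. length I = 1 \<longrightarrow> length J = 1 \<longrightarrow>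
        t d I J = (\<Sum>K | length K = 1. \<Sum>L | length L = 1.
          (\<Prod>a<1. jac c d p (I!a) (K!a)) * (\<Prod>b<1. jac d c p (L!b) (J!b)) * t c K L))
     \<longleftrightarrow> endo_matrix t d = Jac c d p ** endo_matrix t c ** Jac d c p" (is "?L c d \<longleftrightarrow> _") for c d
  proof -
    have eq: "(\<Sum>K | length K = 1. \<Sum>L | length L = 1.
          (\<Prod>a<1. jac c d p ([i]!a) (K!a)) * (\<Prod>b<1. jac d c p (L!b) ([j]!b)) * t c K L)
        = (Jac c d p ** endo_matrix t c ** Jac d c p) $ i $ j" for i j
    proof -
      have "(\<Sum>K | length K = 1. \<Sum>L | length L = 1.
          (\<Prod>a<1. jac c d p ([i]!a) (K!a)) * (\<Prod>b<1. jac d c p (L!b) ([j]!b)) * t c K L)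
        = (\<Sum>k\<in>UNIV. \<Sum>l\<in>UNIV. jac c d p i k * jac d c p l j * t c [k] [l])"
        unfolding sum_singleton_lists by simp
      also have "\<dots> = (\<Sum>l\<in>UNIV. \<Sum>k\<in>UNIV. jac c d p i k * jac d c p l j * t c [k] [l])"
        by (rule sum.swap)
      also have "\<dots> = (Jac c d p ** endo_matrix t c ** Jac d c p) $ i $ j"
        by (simp add: Jac_def endo_matrix_def matrix_matrix_mult_def sum_distrib_right sum_distrib_left mult_ac)
      finally show ?thesis .
    qed
    have "?L c d \<longleftrightarrow> (\<forall>I. length I = 1 \<longrightarrow> (\<forall>J. length J = 1 \<longrightarrow>
        t d I J = (\<Sum>K | length K = 1. \<Sum>L | length L = 1.
          (\<Prod>a<1. jac c d p (I!a) (K!a)) * (\<Prod>b<1. jac d c p (L!b) (J!b)) * t c K L)))"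
      by blast
    also have "\<dots> \<longleftrightarrow> (\<forall>i j. t d [i] [j] = (Jac c d p ** endo_matrix t c ** Jac d c p) $ i $ j)"
      unfolding all_singleton_lists eq ..
    finally show ?thesis by (simp add: vec_eq_iff endo_matrix_def)
  qed
  then show ?thesis unfolding tensor_at_def by (simp only:)
qed

text \<open>The \<open>j\<close>-th vector of the frame that is given in each chart by the columns of a matrix. It is used as a
tensor of type (1,0), so only the single contravariant index \<open>hd I\<close> matters.\<close>

definition frame_vector :: "(('m, 'n::finite) chart \<Rightarrow> real^'n^'n) \<Rightarrow> 'n \<Rightarrow> ('m, 'n) tensor" where
  "frame_vector M j c I L = M c $ hd I $ j"

lemma vector_coords_frame_vector: "vector_coords (frame_vector M j) c = column j (M c)"
  by (simp add: vector_coords_def frame_vector_def column_def)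

lemma tensor_at_frame_vector:
  assumes "\<And>c d. c \<in> charts_at A p \<Longrightarrow> d \<in> charts_at A p \<Longrightarrow> M d = Jac c d p ** M c"
  shows "tensor_at A 1 0 p (frame_vector M j)"
  unfolding tensor_at_1_0_iff vector_coords_frame_vector
proof (intro ballI)
  fix c d assume cd: "c \<in> charts_at A p" "d \<in> charts_at A p"
  have "column j (M d) = column j (Jac c d p ** M c)" by (rule arg_cong[OF assms[OF cd]])
  also have "\<dots> = Jac c d p *v column j (M c)"
    by (simp add: vec_eq_iff column_def matrix_matrix_mult_def matrix_vector_mult_def)
  finally show "column j (M d) = Jac c d p *v column j (M c)" .
qed

lemma basis_at_frame_vector:
  assumes "\<And>c d. c \<in> charts_at A p \<Longrightarrow> d \<in> charts_at A p \<Longrightarrow> M d = Jac c d p ** M c"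
    and "\<And>c. c \<in> charts_at A p \<Longrightarrow> invertible (M c)"
  shows "basis_at A p (frame_vector M)"
  unfolding basis_at_def
proof (intro conjI allI ballI)
  show "tensor_at A 1 0 p (frame_vector M j)" for j by (rule tensor_at_frame_vector[OF assms(1)])
  show "invertible (\<chi> i j. frame_vector M j c [i] [])" if "c \<in> charts_at A p" for c
    using assms(2)[OF that] by (simp add: frame_vector_def)
qed

section \<open>Jacobian matrices of coordinate changes\<close>

locale C2_manifold =
  fixes A :: "('m::t2_space, 'n::finite) chart set"
  assumes atlas: "C2_atlas A"
begin

lemma chart_exists: obtains c where "c \<in> charts_at A p"
  using atlas unfolding C2_atlas_def charts_at_def by blast

lemma charts_atD: "c \<in> charts_at A p \<Longrightarrow> c \<in> A" "c \<in> charts_at A p \<Longrightarrow> p \<in> fst c"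
  by (auto simp: charts_at_def)

context
  fixes c assumes c: "c \<in> A"
begin

lemma chart_homeomorphism: "homeomorphism (fst c) (snd c ` fst c) (snd c) (param c)"
  using atlas c by (auto simp: C2_atlas_def)

lemma open_chart: "open (fst c)" and open_chart_image: "open (snd c ` fst c)"
  using atlas c by (auto simp: C2_atlas_def)

lemma param_coords [simp]: "p \<in> fst c \<Longrightarrow> param c (snd c p) = p"
  using chart_homeomorphism by (auto simp: homeomorphism_def)

lemma continuous_on_coords: "continuous_on (fst c) (snd c)"
  using chart_homeomorphism by (auto simp: homeomorphism_def)

lemma continuous_on_param: "continuous_on (snd c ` fst c) (param c)"
  using chart_homeomorphism by (auto simp: homeomorphism_def)

lemma open_coords_image:
  assumes "open V" shows "open (snd c ` (V \<inter> fst c))"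
proof -
  have "snd c ` (V \<inter> fst c) = snd c ` fst c \<inter> param c -` V" by auto
  then show ?thesis
    using continuous_open_preimage[OF continuous_on_param open_chart_image assms] by simp
qed

end

text \<open>The Jacobian matrix in terms of the derivatives of the transition map, which, unlike the partial
derivatives that define it, can be differentiated once more as a whole.\<close>

lemma transition_derivatives:
  assumes "c \<in> A" "d \<in> A"
  obtains h' h'' where
    "\<And>p. p \<in> fst c \<inter> fst d \<Longrightarrow> ((snd d \<circ> param c) has_derivative blinfun_apply (h' (snd c p))) (at (snd c p))"
    "\<And>p. p \<in> fst c \<inter> fst d \<Longrightarrow> (h' has_derivative blinfun_apply (h'' (snd c p))) (at (snd c p))"
    "C1_on (snd c ` (fst c \<inter> fst d)) h'"
    "\<And>p. p \<in> fst c \<inter> fst d \<Longrightarrow> Jac c d p = matrix (blinfun_apply (h' (snd c p)))"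
proof -
  let ?S = "snd c ` (fst c \<inter> fst d)"
  have "C2_on ?S (snd d \<circ> param c)" using atlas assms by (auto simp: C2_atlas_def)
  then obtain h' where h': "\<And>x. x \<in> ?S \<Longrightarrow> ((snd d \<circ> param c) has_derivative blinfun_apply (h' x)) (at x)"
    "C1_on ?S h'" unfolding C2_on_def by blast
  obtain h'' where h'': "\<And>x. x \<in> ?S \<Longrightarrow> (h' has_derivative blinfun_apply (h'' x)) (at x)"
    using h'(2) unfolding C1_on_def by blast
  have "Jac c d p = matrix (blinfun_apply (h' (snd c p)))" if p: "p \<in> fst c \<inter> fst d" for p
  proof -
    have "((\<lambda>x. (snd d \<circ> param c) x $ i) has_derivative (\<lambda>v. h' (snd c p) v $ i)) (at (snd c p))" for i
      using p by (intro bounded_linear.has_derivative[OF bounded_linear_vec_nth] h') auto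
    then have "frechet_derivative ((\<lambda>q. snd d q $ i) \<circ> param c) (at (snd c p)) = (\<lambda>v. h' (snd c p) v $ i)" for i
      using frechet_derivative_at[symmetric] by (fastforce simp: o_def)
    then show ?thesis by (simp add: Jac_def jac_def pd_def matrix_def)
  qed
  then show ?thesis using that[of h' h''] h' h'' by auto
qed

lemma transition_has_derivative:
  assumes "c \<in> A" "d \<in> A" "p \<in> fst c" "p \<in> fst d"
  shows "((snd d \<circ> param c) has_derivative (\<lambda>v. Jac c d p *v v)) (at (snd c p))"
proof -
  obtain h' h'' where "\<And>p. p \<in> fst c \<inter> fst d \<Longrightarrow>
      ((snd d \<circ> param c) has_derivative blinfun_apply (h' (snd c p))) (at (snd c p))"
    and J: "\<And>p. p \<in> fst c \<inter> fst d \<Longrightarrow> Jac c d p = matrix (blinfun_apply (h' (snd c p)))"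
    using transition_derivatives[OF assms(1,2)] by metis
  moreover have "Jac c d p *v v = h' (snd c p) v" for v
    using assms by (simp add: J matrix_blinfun_apply)
  ultimately show ?thesis using assms by simp
qed

lemma Jac_cocycle:
  assumes c: "c \<in> charts_at A p" and d: "d \<in> charts_at A p" and e: "e \<in> charts_at A p"
  shows "Jac d e p ** Jac c d p = Jac c e p"
proof -
  note mem = charts_atD[OF c] charts_atD[OF d] charts_atD[OF e]
  have cd: "((snd d \<circ> param c) has_derivative (\<lambda>v. Jac c d p *v v)) (at (snd c p))"
    using mem by (intro transition_has_derivative)
  have de: "((snd e \<circ> param d) has_derivative (\<lambda>v. Jac d e p *v v)) (at ((snd d \<circ> param c) (snd c p)))"
    using mem transition_has_derivative[of d e p] by simp
  have "((\<lambda>x. (snd e \<circ> param d) ((snd d \<circ> param c) x)) has_derivative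
      (\<lambda>v. Jac d e p *v (Jac c d p *v v))) (at (snd c p))"
    by (rule has_derivative_compose[OF cd de])
  moreover have "open (snd c ` (fst d \<inter> fst c))" using mem by (intro open_coords_image open_chart)
  ultimately have "((snd e \<circ> param c) has_derivative (\<lambda>v. Jac d e p *v (Jac c d p *v v))) (at (snd c p))"
    by (rule has_derivative_transform_within_open) (use mem in auto)
  then have "(\<lambda>v. Jac d e p *v (Jac c d p *v v)) = (\<lambda>v. Jac c e p *v v)"
    using has_derivative_unique transition_has_derivative mem by blast
  then show ?thesis
    by (simp add: matrix_eq matrix_vector_mul_assoc[symmetric] fun_eq_iff)
qed

lemma Jac_self:
  assumes c: "c \<in> charts_at A p"
  shows "Jac c c p = mat 1"
proof -
  note mem = charts_atD[OF c]
  have "((\<lambda>x. x) has_derivative (\<lambda>v. v)) (at (snd c p))" by (rule has_derivative_ident)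
  moreover have "open (snd c ` fst c)" using mem by (intro open_chart_image)
  ultimately have "((snd c \<circ> param c) has_derivative (\<lambda>v. v)) (at (snd c p))"
    by (rule has_derivative_transform_within_open) (use mem in auto)
  then have "(\<lambda>v. v) = (\<lambda>v. Jac c c p *v v)"
    using has_derivative_unique transition_has_derivative mem by blast
  then show ?thesis by (metis matrix_eq matrix_vector_mul_lid)
qed

lemma Jac_inverse:
  assumes "c \<in> charts_at A p" "d \<in> charts_at A p"
  shows "Jac c d p ** Jac d c p = mat 1"
  using Jac_cocycle[OF assms(2,1,2)] Jac_self[OF assms(2)] by simp

lemma Jac_invertible:
  assumes "c \<in> charts_at A p" "d \<in> charts_at A p"
  shows "invertible (Jac c d p)"
  using Jac_inverse[OF assms] Jac_inverse[OF assms(2,1)] unfolding invertible_def by blast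

lemma C1_on_Jac:
  assumes c: "c \<in> A" and d: "d \<in> A" and e: "e \<in> A"
  shows "C1_on (snd e ` (fst c \<inter> fst d \<inter> fst e)) (\<lambda>x. Jac c d (param e x))"
proof -
  let ?S = "snd e ` (fst c \<inter> fst d \<inter> fst e)"
  obtain h' where h': "C1_on (snd c ` (fst c \<inter> fst d)) h'"
    "\<And>p. p \<in> fst c \<inter> fst d \<Longrightarrow> Jac c d p = matrix (blinfun_apply (h' (snd c p)))"
    using transition_derivatives[OF c d] by metis
  have "C2_on (snd e ` (fst e \<inter> fst c)) (snd c \<circ> param e)"
    using atlas c e by (auto simp: C2_atlas_def)
  then have "C1_on (snd e ` (fst e \<inter> fst c)) (\<lambda>x. snd c (param e x))"
    using C2_on_imp_C1_on by (simp add: o_def)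
  then have "C1_on ?S (\<lambda>x. snd c (param e x))"
    by (rule C1_on_subset) auto
  then have "C1_on ?S (\<lambda>x. matrix (blinfun_apply (h' (snd c (param e x)))))"
    using e by (intro C1_on_bounded_linear_compose[OF bounded_linear_matrix_of_blinfun] C1_on_compose[OF _ h'(1)])
      auto
  moreover have "open ?S" using c d e by (intro open_coords_image open_Int open_chart)
  ultimately show ?thesis by (rule C1_on_cong) (use e h'(2) in auto)
qed

lemma vector_coords_transform:
  assumes "tensor_at A 1 0 p t" "c \<in> charts_at A p" "d \<in> charts_at A p"
  shows "vector_coords t d = Jac c d p *v vector_coords t c"
  using assms unfolding tensor_at_1_0_iff by blast

lemma C1_vector_field_has_derivative:
  assumes X: "C1_vector_field A U X" and c: "c \<in> A" and p: "p \<in> U" "p \<in> fst c"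
  shows "((\<lambda>x. vector_coords (X (param c x)) c) has_derivative (\<lambda>v. D_coords X c p *v v)) (at (snd c p))"
    (is "(?f has_derivative _) _")
proof -
  have "?f differentiable (at (snd c p))"
  proof -
    have "C1_on (snd c ` (U \<inter> fst c)) ((\<lambda>p. X p c [i] []) \<circ> param c)" for i
      using X c unfolding C1_tensor_field_def by simp
    then have "\<exists>D. (((\<lambda>p. X p c [i] []) \<circ> param c) has_derivative D) (at (snd c p))" for i
      using p unfolding C1_on_def by (meson IntI imageI)
    then obtain D where D: "\<And>i. (((\<lambda>p. X p c [i] []) \<circ> param c) has_derivative D i) (at (snd c p))"
      by metis
    have "(?f has_derivative (\<lambda>v. \<Sum>i\<in>UNIV. D i v *\<^sub>R axis i 1)) (at (snd c p))"
    proof -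
      have "?f = (\<lambda>x. \<Sum>i\<in>UNIV. ((\<lambda>p. X p c [i] []) \<circ> param c) x *\<^sub>R axis i 1)"
        using basis_expansion[of "vector_coords (X _) c"]
        by (simp add: vector_coords_def scalar_mult_eq_scaleR fun_eq_iff)
      then show ?thesis by (simp only:) (intro has_derivative_sum has_derivative_scaleR_left D)
    qed
    then show ?thesis unfolding differentiable_def by blast
  qed
  then obtain D where D: "(?f has_derivative D) (at (snd c p))" unfolding differentiable_def by blast
  have "frechet_derivative ((\<lambda>q. X q c [i] []) \<circ> param c) (at (snd c p)) = (\<lambda>v. D v $ i)" for i
  proof -
    have "((\<lambda>x. ?f x $ i) has_derivative (\<lambda>v. D v $ i)) (at (snd c p))"
      by (rule bounded_linear.has_derivative[OF bounded_linear_vec_nth D])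
    then show ?thesis
      by (intro frechet_derivative_at[symmetric]) (simp add: vector_coords_def o_def)
  qed
  then have "D_coords X c p = matrix D" by (simp add: D_coords_def pd_def matrix_def)
  then show ?thesis using D matrix_apply[OF has_derivative_linear[OF D]] by simp
qed

text \<open>The velocity of the curve is the value of a C1 field, and this field must obey the transformation law of
vectors at all points, not only on the curve. Let \<open>h\<close> be the transition
map, so that \<open>h' y (X\<^sub>c y) = X\<^sub>d (h y)\<close> for the coordinates \<open>X\<^sub>c\<close> and \<open>X\<^sub>d\<close> of the field. Differentiating
this in the direction \<open>v\<close> gives \<open>h'' v X\<^sub>c + h' (DX\<^sub>c v) = DX\<^sub>d (h' v)\<close>. The derivative wanted is the map
\<open>v \<mapsto> h'' X\<^sub>c v\<close>, which equals \<open>v \<mapsto> h'' v X\<^sub>c\<close> by symmetry.\<close>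

lemma Jac_along_curve:
  assumes X: "C1_vector_field A U X" and U: "open U"
    and c: "c \<in> charts_at A (\<gamma> s)" and d: "d \<in> charts_at A (\<gamma> s)" and s: "s \<in> K" "\<gamma> s \<in> U"
    and cont: "continuous_on K \<gamma>"
    and \<gamma>': "((snd c \<circ> \<gamma>) has_vector_derivative vector_coords (X (\<gamma> s)) c) (at s within K)"
  shows "((\<lambda>t. Jac c d (\<gamma> t)) has_vector_derivative
      D_coords X d (\<gamma> s) ** Jac c d (\<gamma> s) - Jac c d (\<gamma> s) ** D_coords X c (\<gamma> s)) (at s within K)"
proof -
  define p where "p = \<gamma> s"
  note mem = charts_atD[OF c, folded p_def] charts_atD[OF d, folded p_def]
  define x where "x = snd c p"
  obtain h' h'' where h': "\<And>q. q \<in> fst c \<inter> fst d \<Longrightarrow>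
      ((snd d \<circ> param c) has_derivative blinfun_apply (h' (snd c q))) (at (snd c q))"
    and h'': "\<And>q. q \<in> fst c \<inter> fst d \<Longrightarrow> (h' has_derivative blinfun_apply (h'' (snd c q))) (at (snd c q))"
    and J: "\<And>q. q \<in> fst c \<inter> fst d \<Longrightarrow> Jac c d q = matrix (blinfun_apply (h' (snd c q)))"
    using transition_derivatives[OF mem(1,3)] by metis
  have Jv: "Jac c d q *v v = h' (snd c q) v" if "q \<in> fst c \<inter> fst d" for q v
    using that by (simp add: J matrix_blinfun_apply)
  define Xc where "Xc y = vector_coords (X (param c y)) c" for y
  define Xd where "Xd y = vector_coords (X (param d y)) d" for y
  have dXc: "(Xc has_derivative (\<lambda>v. D_coords X c p *v v)) (at x)"
    unfolding Xc_def[abs_def] x_def using mem s(2) by (intro C1_vector_field_has_derivative[OF X]) (auto simp: p_def)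
  have "(Xd has_derivative (\<lambda>v. D_coords X d p *v v)) (at (snd d p))"
    unfolding Xd_def[abs_def] using mem s(2) by (intro C1_vector_field_has_derivative[OF X]) (auto simp: p_def)
  then have dXd: "((\<lambda>y. Xd ((snd d \<circ> param c) y)) has_derivative (\<lambda>v. D_coords X d p *v (h' x v))) (at x)"
    unfolding x_def using mem by (intro has_derivative_compose[OF h']) auto
  have prod: "((\<lambda>y. h' y (Xc y)) has_derivative (\<lambda>v. h' x (D_coords X c p *v v) + h'' x v (Xc x))) (at x)"
    using bounded_bilinear.FDERIV[OF bounded_bilinear_blinfun_apply h''[of p] dXc[unfolded x_def]] mem
    by (simp add: x_def)
  \<comment> \<open>The identity \<open>h' y (X\<^sub>c y) = X\<^sub>d (h y)\<close> holds near \<open>x\<close>; both sides are differentiated at \<open>x\<close>.\<close>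
  have oS: "open (snd c ` (U \<inter> fst d \<inter> fst c))"
    using mem U by (intro open_coords_image open_Int open_chart) auto
  have "((\<lambda>y. h' y (Xc y)) has_derivative (\<lambda>v. D_coords X d p *v (h' x v))) (at x)"
  proof (rule has_derivative_transform_within_open[OF dXd oS])
    show "x \<in> snd c ` (U \<inter> fst d \<inter> fst c)" using mem s(2) by (auto simp: x_def p_def)
    fix y assume "y \<in> snd c ` (U \<inter> fst d \<inter> fst c)"
    then obtain q where q: "q \<in> U" "q \<in> fst d" "q \<in> fst c" "y = snd c q" by blast
    then have "vector_coords (X q) d = Jac c d q *v vector_coords (X q) c"
      using X mem by (intro vector_coords_transform) (auto simp: C1_tensor_field_def charts_at_def)
    then show "Xd ((snd d \<circ> param c) y) = h' y (Xc y)"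
      using q mem Jv by (simp add: Xd_def Xc_def)
  qed
  then have eq: "D_coords X d p *v (h' x v) = h' x (D_coords X c p *v v) + h'' x v (Xc x)" for v
    using has_derivative_unique[OF _ prod] by (metis (no_types, lifting))
  have sym: "h'' x v w = h'' x w v" for v w
    using mem second_derivative_symmetric[of "snd c ` (fst d \<inter> fst c)" x "snd d \<circ> param c" h' "h'' x" v w]
      open_coords_image[OF mem(1) open_chart[OF mem(3)]] h' h''[of p]
    by (auto simp: x_def)
  have "((\<lambda>t. h' (snd c (\<gamma> t))) has_vector_derivative h'' x (Xc x)) (at s within K)"
    using has_derivative_compose[OF \<gamma>'[unfolded has_vector_derivative_def], of h' "h'' x"] h''[of p] mem
    by (simp add: has_vector_derivative_def x_def p_def Xc_def o_def blinfun.scaleR_right)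
  then have "((\<lambda>t. matrix (blinfun_apply (h' (snd c (\<gamma> t))))) has_vector_derivative
      matrix (blinfun_apply (h'' x (Xc x)))) (at s within K)"
    by (rule bounded_linear.has_vector_derivative[OF bounded_linear_matrix_of_blinfun])
  moreover have "matrix (blinfun_apply (h'' x (Xc x))) = D_coords X d p ** Jac c d p - Jac c d p ** D_coords X c p"
  proof -
    have "matrix (blinfun_apply (h'' x (Xc x))) *v v = h'' x (Xc x) v" for v
      by (rule matrix_blinfun_apply)
    moreover have "h'' x (Xc x) v = D_coords X d p *v (h' x v) - h' x (D_coords X c p *v v)" for v
      using eq[of v] sym[of v "Xc x"] by simp
    ultimately show ?thesis
      using Jv[of p] mem
      by (simp add: matrix_eq matrix_vector_mult_diff_rdistrib matrix_vector_mul_assoc[symmetric] x_def)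
  qed
  ultimately have main: "((\<lambda>t. matrix (blinfun_apply (h' (snd c (\<gamma> t))))) has_vector_derivative
      D_coords X d p ** Jac c d p - Jac c d p ** D_coords X c p) (at s within K)" by simp
  have "open (fst c \<inter> fst d)" using mem open_chart by blast
  then have "\<forall>\<^sub>F t in at s within K. \<gamma> t \<in> fst c \<inter> fst d"
    using cont s(1) mem unfolding continuous_on_def p_def by (auto dest!: topological_tendstoD)
  then have "\<forall>\<^sub>F t in at s within K. matrix (blinfun_apply (h' (snd c (\<gamma> t)))) = Jac c d (\<gamma> t)"
    by eventually_elim (simp add: J)
  then show ?thesis
    using has_vector_derivative_transform_eventually[OF main _ s(1), of "\<lambda>t. Jac c d (\<gamma> t)"] J[of p] mem
    by (simp add: p_def)
qed

end

section \<open>Parallel frames along the path\<close>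

text \<open>The interval \<open>J\<close> may be open or closed at its ends, while differential equations are solved and curves
are continued on compact intervals. Near \<open>s\<close> the two look the same, also at an end point of \<open>J\<close>, so
that derivatives within them agree.\<close>

lemma interval_local_compact:
  fixes J :: "real set"
  assumes J: "is_interval J" "a \<in> J" "b \<in> J" "a < b" and s: "s \<in> J" and t: "t \<in> J"
  obtains l u where "l < u" "{l..u} \<subseteq> J" "s \<in> {l..u}" "t \<in> {l..u}" "at s within {l..u} = at s within J"
    "\<forall>\<^sub>F r in at s within J. r \<in> {l..u}"
proof -
  define l0 where "l0 = min a (min s t)"
  define u0 where "u0 = max b (max s t)"
  have lu0: "l0 \<in> J" "u0 \<in> J" using J s t by (auto simp: l0_def u0_def min_def max_def)
  \<comment> \<open>If \<open>l0 = s\<close>, move further to the left, unless \<open>s\<close> is the left end point of \<open>J\<close>.\<close>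
  obtain l where l: "l \<in> J" "l \<le> l0" "l0 = s \<Longrightarrow> l < s \<or> (\<forall>r\<in>J. s \<le> r)"
    using lu0(1) by (metis dual_order.refl linorder_not_le order_less_imp_le)
  obtain u where u: "u \<in> J" "u0 \<le> u" "u0 = s \<Longrightarrow> s < u \<or> (\<forall>r\<in>J. r \<le> s)"
    using lu0(2) by (metis dual_order.refl linorder_not_le order_less_imp_le)
  have l_le: "l \<le> a" "l \<le> s" "l \<le> t" and u_ge: "b \<le> u" "s \<le> u" "t \<le> u"
    using l(2) u(2) by (auto simp: l0_def u0_def)
  have sub: "{l..u} \<subseteq> J" using J(1) l(1) u(1) unfolding is_interval_1 by (meson atLeastAtMost_iff subsetI)
  \<comment> \<open>If \<open>s\<close> is the left end point of \<open>J\<close>, then \<open>l = s\<close> and any number below \<open>s\<close> can bound the neighbourhood.\<close>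
  define m where "m = (if l < s then l else s - 1)"
  define n where "n = (if s < u then u else s + 1)"
  have mn: "m < s" "s < n" using l_le u_ge by (auto simp: m_def n_def)
  have nb: "r \<in> {l..u}" if "r \<in> J" "r \<in> {m<..<n}" for r
  proof -
    have "l \<le> r"
    proof (cases "l < s")
      case True then show ?thesis using that by (auto simp: m_def)
    next
      case False
      then have "l0 = s" "l = s" using l(2) l_le by (auto simp: l0_def)
      then show ?thesis using l(3) that(1) by auto
    qed
    moreover have "r \<le> u"
    proof (cases "s < u")
      case True then show ?thesis using that by (auto simp: n_def)
    next
      case False
      then have "u0 = s" "u = s" using u(2) u_ge by (auto simp: u0_def)
      then show ?thesis using u(3) that(1) by auto
    qed
    ultimately show ?thesis by simp
  qed
  have "at s within {l..u} = at s within J"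
    using mn nb sub by (intro at_within_nhd[of s "{m<..<n}"]) auto
  moreover have "\<forall>\<^sub>F r in at s within J. r \<in> {l..u}"
    unfolding eventually_at_topological using mn nb by (intro exI[of _ "{m<..<n}"]) auto
  ultimately show ?thesis using that[of l u] sub l_le u_ge J(4) by auto
qed

locale S_derivation_on_path = C2_manifold A
  for A :: "('m::{t2_space,second_countable_topology}, 'n::finite) chart set" +
  fixes J :: "real set" and a b :: real and \<gamma> :: "real \<Rightarrow> 'm" and U :: "'m set"
    and S :: "('m \<Rightarrow> ('m, 'n) tensor) \<Rightarrow> 'm \<Rightarrow> ('m, 'n) tensor"
    and X :: "'m \<Rightarrow> ('m, 'n) tensor"
  assumes interval: "is_interval J" "a \<in> J" "b \<in> J" "a < b"
    and path: "C1_path A J \<gamma>"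
    and nbhd: "open U" "\<gamma> ` J \<subseteq> U"
    and SX: "C0_tensor_field A 1 1 U (S X)"
    and X: "C1_vector_field A U X" "reduces_to_tangent A J \<gamma> X"
begin

lemma \<gamma>_in_U: "s \<in> J \<Longrightarrow> \<gamma> s \<in> U" using nbhd(2) by blast

lemma continuous_\<gamma>: "continuous_on J \<gamma>" using path by (simp add: C1_path_def)

lemma at_within_J_nontrivial:
  assumes "s \<in> J" shows "at s within J \<noteq> bot"
proof -
  have "connected J" using interval(1) is_interval_connected by blast
  then show ?thesis
    using connected_imp_perfect[of J s] assms interval
    by (metis islimpt_UNIV less_irrefl singletonD trivial_limit_within)
qed

lemma coords_has_vector_derivative:
  assumes s: "s \<in> J" and c: "c \<in> charts_at A (\<gamma> s)"
  shows "((snd c \<circ> \<gamma>) has_vector_derivative vector_coords (X (\<gamma> s)) c) (at s within J)"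
proof -
  have "\<exists>v. ((snd c \<circ> \<gamma>) has_vector_derivative v) (at s within J)"
    using path s charts_atD[OF c] unfolding C1_path_def C1_curve_on_def by blast
  then have "((snd c \<circ> \<gamma>) has_vector_derivative velocity J \<gamma> s c) (at s within J)"
    unfolding velocity_def using vector_derivative_within[OF at_within_J_nontrivial[OF s]] by metis
  moreover have "velocity J \<gamma> s c = vector_coords (X (\<gamma> s)) c"
    using X(2) s c unfolding reduces_to_tangent_def vector_coords_def by (simp add: vec_eq_iff)
  ultimately show ?thesis by simp
qed

lemma eventually_in_chart:
  assumes "s \<in> J" "c \<in> charts_at A (\<gamma> s)"
  shows "\<forall>\<^sub>F t in at s within J. \<gamma> t \<in> fst c"
  using continuous_\<gamma> assms open_chart[of c] charts_atD[of c]
  unfolding continuous_on_def by (auto dest!: topological_tendstoD)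

text \<open>The components of \<open>D\<^sub>X\<close> in the coordinate basis of the chart \<open>c\<close>: the coordinates of its vectors are
constant, so only the terms without derivatives of them remain.\<close>

definition chart_components :: "('m, 'n) chart \<Rightarrow> 'm \<Rightarrow> real^'n^'n" where
  "chart_components c p = endo_matrix (S X p) c - D_coords X c p"

lemma S_derivation_along_vector:
  "S_derivation_along J \<gamma> S X T s c [i] [] =
    vector_derivative (\<lambda>t. T t c [i] []) (at s within J) + (chart_components c (\<gamma> s) *v vector_coords (T s) c) $ i"
  by (simp add: S_derivation_along_def endo_action_def chart_components_def endo_matrix_def D_coords_def
      vector_coords_def matrix_vector_mult_def)

lemma continuous_on_chart_components:
  assumes c: "c \<in> A"
  shows "continuous_on {t\<in>J. \<gamma> t \<in> fst c} (\<lambda>t. chart_components c (\<gamma> t))"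
proof -
  let ?T = "{t\<in>J. \<gamma> t \<in> fst c}"
  have c\<gamma>: "continuous_on ?T \<gamma>" using continuous_\<gamma> by (rule continuous_on_subset) auto
  have "continuous_on ?T (\<lambda>t. S X (\<gamma> t) c [i] [k])" for i k
    using SX c \<gamma>_in_U unfolding C0_tensor_field_def
    by (intro continuous_on_compose2[OF _ c\<gamma>, of "U \<inter> fst c"]) auto
  moreover have "continuous_on ?T (\<lambda>t. pd c k (\<lambda>q. X q c [i] []) (\<gamma> t))" for i k
  proof -
    have "C1_on (snd c ` (U \<inter> fst c)) ((\<lambda>p. X p c [i] []) \<circ> param c)"
      using X(1) c unfolding C1_tensor_field_def by simp
    moreover have "continuous_on ?T (\<lambda>t. snd c (\<gamma> t))"
      using continuous_on_compose2[OF continuous_on_coords[OF c] c\<gamma>] by auto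
    ultimately show ?thesis
      unfolding pd_def using \<gamma>_in_U
      by (intro continuous_on_compose2[OF C1_on_frechet_derivative_continuous]) auto
  qed
  ultimately show ?thesis
    unfolding chart_components_def endo_matrix_def D_coords_def by (intro continuous_intros)
qed

lemma chart_components_transform:
  assumes s: "s \<in> J" and c: "c \<in> charts_at A (\<gamma> s)" and d: "d \<in> charts_at A (\<gamma> s)"
  shows "chart_components d (\<gamma> s) ** Jac c d (\<gamma> s) =
    Jac c d (\<gamma> s) ** endo_matrix (S X (\<gamma> s)) c - D_coords X d (\<gamma> s) ** Jac c d (\<gamma> s)"
proof -
  have "endo_matrix (S X (\<gamma> s)) d = Jac c d (\<gamma> s) ** endo_matrix (S X (\<gamma> s)) c ** Jac d c (\<gamma> s)"
    using SX \<gamma>_in_U[OF s] c d unfolding C0_tensor_field_def tensor_at_1_1_iff by blast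
  then have "endo_matrix (S X (\<gamma> s)) d ** Jac c d (\<gamma> s) =
      Jac c d (\<gamma> s) ** endo_matrix (S X (\<gamma> s)) c"
    using Jac_inverse[OF d c] by (simp add: matrix_mul_assoc[symmetric])
  then show ?thesis
    by (simp add: chart_components_def bounded_bilinear.diff_left[OF bounded_bilinear_matrix_mul])
qed

text \<open>The equation of parallel frames has the same form in all charts. The product rule produces the
derivative of \<open>Jac c d\<close> along \<open>\<gamma>\<close>, which cancels the failure of \<open>D_coords X\<close> to transform like an
endomorphism.\<close>

lemma parallel_transform:
  fixes M :: "real \<Rightarrow> real^'n^'n"
  assumes K: "s \<in> K" "K \<subseteq> J" and c: "c \<in> charts_at A (\<gamma> s)" and d: "d \<in> charts_at A (\<gamma> s)"
    and M: "(M has_vector_derivative - (chart_components c (\<gamma> s) ** M s)) (at s within K)"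
  shows "((\<lambda>t. Jac c d (\<gamma> t) ** M t) has_vector_derivative
      - (chart_components d (\<gamma> s) ** (Jac c d (\<gamma> s) ** M s))) (at s within K)"
proof -
  interpret mul: bounded_bilinear "(**) :: real^'n^'n \<Rightarrow> real^'n^'n \<Rightarrow> real^'n^'n"
    by (rule bounded_bilinear_matrix_mul)
  have s: "s \<in> J" using K by blast
  let ?J = "Jac c d (\<gamma> s)"
  have J': "((\<lambda>t. Jac c d (\<gamma> t)) has_vector_derivative
      D_coords X d (\<gamma> s) ** ?J - ?J ** D_coords X c (\<gamma> s)) (at s within K)"
    using c d K(1) \<gamma>_in_U[OF s] continuous_on_subset[OF continuous_\<gamma> K(2)]
      has_vector_derivative_within_subset[OF coords_has_vector_derivative[OF s c] K(2)]
    by (intro Jac_along_curve[OF X(1) nbhd(1)])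
  have "((\<lambda>t. Jac c d (\<gamma> t) ** M t) has_vector_derivative
      (?J ** - (chart_components c (\<gamma> s) ** M s) + (D_coords X d (\<gamma> s) ** ?J - ?J ** D_coords X c (\<gamma> s)) ** M s))
      (at s within K)"
    by (rule mul.has_vector_derivative[OF J' M])
  moreover have "?J ** - (chart_components c (\<gamma> s) ** M s) + (D_coords X d (\<gamma> s) ** ?J - ?J ** D_coords X c (\<gamma> s)) ** M s
      = - (chart_components d (\<gamma> s) ** (?J ** M s))"
  proof -
    have "chart_components d (\<gamma> s) ** (?J ** M s) =
        (?J ** endo_matrix (S X (\<gamma> s)) c - D_coords X d (\<gamma> s) ** ?J) ** M s"
      by (simp add: matrix_mul_assoc chart_components_transform[OF s c d])
    then show ?thesis
      by (simp add: chart_components_def mul.diff_left mul.diff_right mul.minus_left mul.minus_right matrix_mul_assoc)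
  qed
  ultimately show ?thesis by simp
qed

text \<open>A frame at each parameter in \<open>K\<close>, given by its coordinate matrices in all charts around the point
\<open>\<gamma> s\<close>; its values in other charts are arbitrary.\<close>

definition frame_field :: "real set \<Rightarrow> (real \<Rightarrow> ('m, 'n) chart \<Rightarrow> real^'n^'n) \<Rightarrow> bool" where
  "frame_field K F \<longleftrightarrow> (\<forall>s\<in>K. \<forall>c\<in>charts_at A (\<gamma> s). invertible (F s c) \<and>
     (\<forall>d\<in>charts_at A (\<gamma> s). F s d = Jac c d (\<gamma> s) ** F s c))"

definition parallel :: "real set \<Rightarrow> (real \<Rightarrow> ('m, 'n) chart \<Rightarrow> real^'n^'n) \<Rightarrow> bool" where
  "parallel K F \<longleftrightarrow> frame_field K F \<and> (\<forall>s\<in>K. \<forall>c\<in>charts_at A (\<gamma> s).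
     ((\<lambda>t. F t c) has_vector_derivative - (chart_components c (\<gamma> s) ** F s c)) (at s within K))"

lemma parallel_transform_law:
  assumes "parallel K F" "s \<in> K" "c \<in> charts_at A (\<gamma> s)" "d \<in> charts_at A (\<gamma> s)"
  shows "F s d = Jac c d (\<gamma> s) ** F s c"
  using assms unfolding parallel_def frame_field_def by blast

lemma parallel_invertible:
  assumes "parallel K F" "s \<in> K" "c \<in> charts_at A (\<gamma> s)"
  shows "invertible (F s c)"
  using assms unfolding parallel_def frame_field_def by blast

lemma parallel_derivative:
  assumes "parallel K F" "s \<in> K" "c \<in> charts_at A (\<gamma> s)"
  shows "((\<lambda>t. F t c) has_vector_derivative - (chart_components c (\<gamma> s) ** F s c)) (at s within K)"
  using assms unfolding parallel_def by blast

lemma parallel_subset: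
  assumes "parallel K F" "L \<subseteq> K" shows "parallel L F"
  using assms unfolding parallel_def frame_field_def
  by (meson has_vector_derivative_within_subset subsetD)

text \<open>Multiplication by a constant matrix from the right forms linear combinations of the vectors of the
frame with constant coefficients, and the equation is linear.\<close>

lemma parallel_mult:
  assumes F: "parallel K F" and C: "invertible C"
  shows "parallel K (\<lambda>t c. F t c ** C)"
proof -
  interpret mul: bounded_bilinear "(**) :: real^'n^'n \<Rightarrow> real^'n^'n \<Rightarrow> real^'n^'n"
    by (rule bounded_bilinear_matrix_mul)
  have "((\<lambda>t. F t c ** C) has_vector_derivative - (chart_components c (\<gamma> s) ** (F s c ** C))) (at s within K)"
    if "s \<in> K" "c \<in> charts_at A (\<gamma> s)" for s c
    using bounded_linear.has_vector_derivative[OF mul.bounded_linear_left parallel_derivative[OF F that], of C]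
    by (simp add: mul.minus_left matrix_mul_assoc)
  then show ?thesis
    using F C unfolding parallel_def frame_field_def
    by (metis invertible_mult matrix_mul_assoc)
qed

lemma parallel_normalize:
  assumes F: "parallel K F" and s: "s \<in> K" and c: "c \<in> charts_at A (\<gamma> s)" and M: "invertible M"
  obtains F' where "parallel K F'" "F' s c = M"
proof -
  obtain N where N: "F s c ** N = mat 1" "N ** F s c = mat 1"
    using parallel_invertible[OF F s c] unfolding invertible_def by blast
  then have "invertible N" unfolding invertible_def by blast
  then have "parallel K (\<lambda>t c. F t c ** (N ** M))" using F M by (intro parallel_mult invertible_mult)
  moreover have "F s c ** (N ** M) = M" by (simp add: matrix_mul_assoc N)
  ultimately show ?thesis using that by blast
qed

lemma compact_interval_in_chart:
  assumes lu: "{l..u} \<subseteq> J" and x: "x \<in> {l..u}" and c: "c \<in> charts_at A (\<gamma> x)"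
  shows "\<exists>\<delta>>0. \<exists>K>0. \<forall>t\<in>{l..u}. \<bar>t - x\<bar> \<le> \<delta> \<longrightarrow> \<gamma> t \<in> fst c \<and> norm (chart_components c (\<gamma> t)) \<le> K"
proof -
  note mem = charts_atD[OF c]
  let ?I = "{t\<in>J. \<gamma> t \<in> fst c}"
  have xI: "x \<in> ?I" using x lu mem by auto
  have "openin (top_of_set J) ?I"
    using continuous_openin_preimage_gen[OF continuous_\<gamma> open_chart[OF mem(1)]] by (simp add: vimage_def Int_def)
  then obtain d1 where d1: "0 < d1" "ball x d1 \<inter> J \<subseteq> ?I"
    using xI unfolding openin_contains_ball by blast
  have "\<exists>d>0. \<forall>t\<in>?I. dist t x < d \<longrightarrow> dist (chart_components c (\<gamma> t)) (chart_components c (\<gamma> x)) < 1"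
    using continuous_on_chart_components[OF mem(1)] xI unfolding continuous_on_iff by (meson zero_less_one)
  then obtain d2 where d2: "0 < d2" "\<And>t. t \<in> ?I \<Longrightarrow> dist t x < d2 \<Longrightarrow> dist (chart_components c (\<gamma> t)) (chart_components c (\<gamma> x)) < 1"
    by blast
  define \<delta> where "\<delta> = min d1 d2 / 2"
  define K where "K = norm (chart_components c (\<gamma> x)) + 1"
  have \<delta>: "0 < \<delta>" "\<delta> < d1" "\<delta> < d2" using d1 d2 by (auto simp: \<delta>_def min_def)
  have inI: "t \<in> ?I" if "t \<in> {l..u}" "\<bar>t - x\<bar> \<le> \<delta>" for t
  proof -
    have "t \<in> ball x d1" using that \<delta> by (auto simp: dist_real_def)
    then show ?thesis using d1 lu that by blast
  qed
  have "norm (chart_components c (\<gamma> t)) \<le> K" if "t \<in> {l..u}" "\<bar>t - x\<bar> \<le> \<delta>" for t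
  proof -
    have "dist (chart_components c (\<gamma> t)) (chart_components c (\<gamma> x)) < 1"
      using inI[OF that] that \<delta> by (intro d2) (auto simp: dist_real_def)
    then show ?thesis unfolding K_def dist_norm by (smt (verit) norm_triangle_sub)
  qed
  moreover have "0 < K" unfolding K_def by (smt (verit) norm_ge_zero)
  ultimately show ?thesis using \<delta>(1) inI by blast
qed

text \<open>The equation is solved in one chart with the unit matrix as value at \<open>x\<close>. By continuity of the
determinant the solution stays invertible near \<open>x\<close>; the Jacobian matrices carry it to all
other charts.\<close>

lemma parallel_exists_local:
  assumes lu: "{l..u} \<subseteq> J" and x: "x \<in> {l..u}"
  obtains \<delta> F where "0 < \<delta>" "parallel {max l (x - \<delta>)..min u (x + \<delta>)} F"
proof -
  interpret mul: bounded_bilinear "(**) :: real^'n^'n \<Rightarrow> real^'n^'n \<Rightarrow> real^'n^'n"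
    by (rule bounded_bilinear_matrix_mul)
  obtain c where c: "c \<in> charts_at A (\<gamma> x)" using chart_exists .
  note mem = charts_atD[OF c]
  obtain \<delta>1 K where pos: "0 < \<delta>1" "0 < K" and bd: "\<forall>t\<in>{l..u}. \<bar>t - x\<bar> \<le> \<delta>1 \<longrightarrow>
      \<gamma> t \<in> fst c \<and> norm (chart_components c (\<gamma> t)) \<le> K"
    using compact_interval_in_chart[OF lu x c] by (elim exE conjE) (rule that)
  have \<delta>1: "0 < \<delta>1" "0 < K" "\<And>t. t \<in> {l..u} \<Longrightarrow> \<bar>t - x\<bar> \<le> \<delta>1 \<Longrightarrow> \<gamma> t \<in> fst c"
    "\<And>t. t \<in> {l..u} \<Longrightarrow> \<bar>t - x\<bar> \<le> \<delta>1 \<Longrightarrow> norm (chart_components c (\<gamma> t)) \<le> K"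
    using pos bd by auto
  obtain L where L: "0 < L" "\<And>(M::real^'n^'n) (N::real^'n^'n). norm (M ** N) \<le> norm M * norm N * L"
    using mul.pos_bounded by blast
  \<comment> \<open>The interval around \<open>x\<close> has length at most \<open>2 * \<delta>2\<close>, and \<open>K * L\<close> bounds the coefficient of the equation.\<close>
  define \<delta>2 where "\<delta>2 = min \<delta>1 (1 / (4 * (K * L)))"
  have KL: "0 < K * L" using \<delta>1 L by simp
  have \<delta>2: "0 < \<delta>2" "\<delta>2 \<le> \<delta>1" "K * L * (2 * \<delta>2) \<le> 1 / 2"
  proof -
    have "K * L * (2 * \<delta>2) \<le> K * L * (2 * (1 / (4 * (K * L))))"
      using KL by (intro mult_left_mono) (auto simp: \<delta>2_def)
    also have "\<dots> = 1 / 2" using \<delta>1(2) L(1) by simp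
    finally show "K * L * (2 * \<delta>2) \<le> 1 / 2" .
  qed (use \<delta>1 KL in \<open>auto simp: \<delta>2_def\<close>)
  define l2 u2 where "l2 = max l (x - \<delta>2)" and "u2 = min u (x + \<delta>2)"
  have sub: "{l2..u2} \<subseteq> {l..u}" by (auto simp: l2_def u2_def)
  have near: "\<bar>t - x\<bar> \<le> \<delta>1" if "t \<in> {l2..u2}" for t using that \<delta>2 by (auto simp: l2_def u2_def)
  have inI: "t \<in> J \<and> \<gamma> t \<in> fst c" if "t \<in> {l2..u2}" for t
    using that near[OF that] sub lu \<delta>1(3) by blast
  define B where "B t = - mul.prod_right (chart_components c (\<gamma> t))" for t
  have B: "blinfun_apply (B t) M = - (chart_components c (\<gamma> t) ** M)" for t M
    by (simp add: B_def blinfun.minus_left)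
  have "continuous_on {l2..u2} (\<lambda>t. chart_components c (\<gamma> t))"
    using continuous_on_chart_components[OF mem(1)] by (rule continuous_on_subset) (use inI in auto)
  then have "continuous_on {l2..u2} B" unfolding B_def
    by (intro continuous_intros bounded_linear.continuous_on[OF mul.bounded_linear_prod_right])
  moreover have "norm (B t) \<le> K * L" if t: "t \<in> {l2..u2}" for t
  proof (rule norm_blinfun_bound)
    fix M :: "real^'n^'n"
    have "norm (B t M) \<le> norm (chart_components c (\<gamma> t)) * norm M * L" using L(2) by (simp add: B)
    also have "\<dots> \<le> K * norm M * L"
      using \<delta>1(4)[of t] t sub near[OF t] L(1) by (intro mult_right_mono) auto
    finally show "norm (B t M) \<le> K * L * norm M" by (simp add: mult_ac)
  qed (use KL in auto)
  moreover have "K * L * (u2 - l2) \<le> 1 / 2"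
  proof -
    have "K * L * (u2 - l2) \<le> K * L * (2 * \<delta>2)"
      using KL by (intro mult_left_mono) (auto simp: l2_def u2_def)
    then show ?thesis using \<delta>2(3) by linarith
  qed
  moreover have x2: "x \<in> {l2..u2}" using x \<delta>2 by (auto simp: l2_def u2_def)
  ultimately obtain y where y: "y x = mat 1"
    "\<And>t. t \<in> {l2..u2} \<Longrightarrow> (y has_vector_derivative B t (y t)) (at t within {l2..u2})"
    using linear_ODE_local[of l2 u2 B "K * L" x "mat 1"] by blast
  have "continuous_on {l2..u2} (\<lambda>t. det (y t))"
    using y(2) by (intro continuous_on_det continuous_on_vector_derivative)
  then have "\<exists>d>0. \<forall>t\<in>{l2..u2}. dist t x < d \<longrightarrow> dist (det (y t)) (det (y x)) < 1"
    using x2 unfolding continuous_on_iff by (meson zero_less_one)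
  then obtain d where d: "0 < d" "\<And>t. t \<in> {l2..u2} \<Longrightarrow> dist t x < d \<Longrightarrow> dist (det (y t)) 1 < 1"
    using y(1) by auto
  define \<delta> where "\<delta> = min \<delta>2 (d / 2)"
  define K' where "K' = {max l (x - \<delta>)..min u (x + \<delta>)}"
  have K': "K' \<subseteq> {l2..u2}" by (auto simp: K'_def l2_def u2_def \<delta>_def)
  have inv: "invertible (y t)" if "t \<in> K'" for t
  proof -
    have "dist t x < d" using that d(1) \<delta>2(1) by (auto simp: K'_def \<delta>_def dist_real_def)
    then have "dist (det (y t)) 1 < 1" using that K' d(2) by blast
    then show ?thesis by (auto simp: invertible_det_nz dist_real_def)
  qed
  define F where "F t e = Jac c e (\<gamma> t) ** y t" for t e
  have "parallel K' F"
    unfolding parallel_def frame_field_def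
  proof (intro conjI ballI)
    fix s e assume s: "s \<in> K'" and e: "e \<in> charts_at A (\<gamma> s)"
    have s2: "s \<in> {l2..u2}" and sJ: "s \<in> J" and cs: "c \<in> charts_at A (\<gamma> s)"
      using s K' inI mem(1) by (auto simp: charts_at_def)
    show "invertible (F s e)"
      unfolding F_def by (intro invertible_mult inv s Jac_invertible cs e)
    show "F s e' = Jac e e' (\<gamma> s) ** F s e" if "e' \<in> charts_at A (\<gamma> s)" for e'
      using Jac_cocycle[OF cs e that] by (simp add: F_def matrix_mul_assoc)
    have "(y has_vector_derivative - (chart_components c (\<gamma> s) ** y s)) (at s within K')"
      using has_vector_derivative_within_subset[OF y(2)[OF s2] K'] by (simp add: B)
    then show "((\<lambda>t. F t e) has_vector_derivative - (chart_components e (\<gamma> s) ** F s e)) (at s within K')"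
      unfolding F_def using K' sub lu by (intro parallel_transform s cs e) blast+
  qed
  then show ?thesis using that[of \<delta> F] \<delta>2(1) d(1) by (simp add: K'_def \<delta>_def)
qed

text \<open>The second frame is multiplied by a constant matrix that makes it agree with the first one at \<open>m\<close>.
Then the one-sided derivatives at \<open>m\<close> agree too, since both are given by the equation.\<close>

lemma parallel_glue:
  assumes F: "parallel {l..m} F" and G: "parallel {m..u} G" and lmu: "l \<le> m" "m \<le> u"
  shows "\<exists>H. parallel {l..u} H"
proof -
  obtain c where c: "c \<in> charts_at A (\<gamma> m)" using chart_exists .
  have "invertible (F m c)" using parallel_invertible[OF F _ c] lmu by auto
  then obtain G' where G': "parallel {m..u} G'" and eq: "G' m c = F m c"
    using parallel_normalize[OF G _ c] lmu by auto
  have eqm: "F m d = G' m d" if "d \<in> charts_at A (\<gamma> m)" for d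
    using parallel_transform_law[OF F _ c that] parallel_transform_law[OF G' _ c that] lmu eq by simp
  define H where "H t d = (if t \<in> {l..m} then F t d else G' t d)" for t d
  have H_F: "H s d = F s d" if "s \<in> {l..m}" for s d using that by (simp add: H_def)
  have H_G: "H s d = G' s d" if "s \<in> {m..u}" "d \<in> charts_at A (\<gamma> s)" for s d
    using that eqm by (cases "s = m") (auto simp: H_def)
  have "parallel {l..u} H"
    unfolding parallel_def
  proof (intro conjI ballI)
    show "frame_field {l..u} H"
      unfolding frame_field_def
    proof (intro ballI)
      fix s c assume s: "s \<in> {l..u}" and c: "c \<in> charts_at A (\<gamma> s)"
      consider "s \<in> {l..m}" | "s \<in> {m..u}" using s by fastforce
      then show "invertible (H s c) \<and> (\<forall>d\<in>charts_at A (\<gamma> s). H s d = Jac c d (\<gamma> s) ** H s c)"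
      proof cases
        case 1
        show ?thesis
          unfolding H_F[OF 1] using parallel_invertible[OF F 1 c] parallel_transform_law[OF F 1 c] by blast
      next
        case 2
        show ?thesis
          using H_G[OF 2] parallel_invertible[OF G' 2 c] parallel_transform_law[OF G' 2 c] c by metis
      qed
    qed
    fix s c assume s: "s \<in> {l..u}" and c: "c \<in> charts_at A (\<gamma> s)"
    \<comment> \<open>The two intervals are closed, so adding the common part of their closures changes nothing.\<close>
    have cl: "{l..m} \<union> (closure {l..m} \<inter> closure {m..u}) = {l..m}"
      "{m..u} \<union> (closure {l..m} \<inter> closure {m..u}) = {m..u}" using lmu by auto
    have "((\<lambda>t. if t \<in> {l..m} then F t c else G' t c) has_vector_derivative
        (if s \<in> {l..m} then - (chart_components c (\<gamma> s) ** F s c) else - (chart_components c (\<gamma> s) ** G' s c))) (at s within {l..u})"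
    proof (rule has_vector_derivative_If_within_closures[where T="{m..u}" and
          f'="\<lambda>s. - (chart_components c (\<gamma> s) ** F s c)" and g'="\<lambda>s. - (chart_components c (\<gamma> s) ** G' s c)"])
      show "{l..u} = {l..m} \<union> {m..u}" using lmu by auto
      then show "s \<in> {l..m} \<union> {m..u}" using s by auto
      assume "s \<in> closure {l..m}" "s \<in> closure {m..u}"
      then have "s = m" by auto
      then show "F s c = G' s c" "- (chart_components c (\<gamma> s) ** F s c) = - (chart_components c (\<gamma> s) ** G' s c)"
        using eqm c by auto
    qed (use parallel_derivative[OF F _ c] parallel_derivative[OF G' _ c] in \<open>simp_all only: cl\<close>)
    then show "((\<lambda>t. H t c) has_vector_derivative - (chart_components c (\<gamma> s) ** H s c)) (at s within {l..u})"
      unfolding H_def by (auto split: if_splits)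
  qed
  then show ?thesis by blast
qed

text \<open>Existence on short intervals around each point and the possibility to join adjacent intervals
give existence on a compact interval, by bisection.\<close>

lemma parallel_exists_compact:
  assumes "{l..u} \<subseteq> J" "l \<le> u"
  shows "\<exists>F. parallel {l..u} F"
proof -
  have "l \<le> l \<longrightarrow> u \<le> u \<longrightarrow> (\<exists>F. parallel {l..u} F)"
    using assms(2)
  proof (rule Bolzano[of l u "\<lambda>v w. l \<le> v \<longrightarrow> w \<le> u \<longrightarrow> (\<exists>F. parallel {v..w} F)"])
    fix p q r
    assume "l \<le> p \<longrightarrow> q \<le> u \<longrightarrow> (\<exists>F. parallel {p..q} F)" "l \<le> q \<longrightarrow> r \<le> u \<longrightarrow> (\<exists>F. parallel {q..r} F)"
      "p \<le> q" "q \<le> r"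
    then show "l \<le> p \<longrightarrow> r \<le> u \<longrightarrow> (\<exists>F. parallel {p..r} F)"
      using parallel_glue by (meson order_trans)
  next
    fix x assume "l \<le> x" "x \<le> u"
    then obtain \<delta> F where \<delta>: "0 < \<delta>" "parallel {max l (x - \<delta>)..min u (x + \<delta>)} F"
      using parallel_exists_local[OF assms(1), of x] by auto
    have "\<exists>F. parallel {v..w} F" if "v \<le> x" "x \<le> w" "w - v < \<delta>" "l \<le> v" "w \<le> u" for v w
      using that by (intro exI[of _ F] parallel_subset[OF \<delta>(2)]) auto
    then show "\<exists>d>0. \<forall>v w. v \<le> x \<and> x \<le> w \<and> w - v < d \<longrightarrow> l \<le> v \<longrightarrow> w \<le> u \<longrightarrow> (\<exists>F. parallel {v..w} F)"
      using \<delta>(1) by blast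
  qed
  then show ?thesis by simp
qed

text \<open>Agreement of two parallel frames propagates: in one chart their difference solves a linear equation,
so it vanishes on a short interval if it vanishes at one point of it. The interval is connected.\<close>

lemma parallel_unique:
  assumes F: "parallel {l..u} F" and G: "parallel {l..u} G" and lu: "{l..u} \<subseteq> J"
    and x: "x \<in> {l..u}" "c \<in> charts_at A (\<gamma> x)" "F x c = G x c"
    and y: "y \<in> {l..u}" "d \<in> charts_at A (\<gamma> y)"
  shows "F y d = G y d"
proof -
  interpret mul: bounded_bilinear "(**) :: real^'n^'n \<Rightarrow> real^'n^'n \<Rightarrow> real^'n^'n"
    by (rule bounded_bilinear_matrix_mul)
  define P where "P s \<longleftrightarrow> (\<forall>d\<in>charts_at A (\<gamma> s). F s d = G s d)" for s
  have PI: "P s" if "s \<in> {l..u}" "c \<in> charts_at A (\<gamma> s)" "F s c = G s c" for s c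
    unfolding P_def
    using that(3) parallel_transform_law[OF F that(1,2)] parallel_transform_law[OF G that(1,2)] by metis
  have "P y"
  proof (rule connected_induction_simple[of "{l..u}" x y P])
    fix z assume z: "z \<in> {l..u}"
    obtain e where e: "e \<in> charts_at A (\<gamma> z)" using chart_exists .
    obtain \<delta>1 K where pos: "0 < \<delta>1" "0 < K" and bd: "\<forall>t\<in>{l..u}. \<bar>t - z\<bar> \<le> \<delta>1 \<longrightarrow>
        \<gamma> t \<in> fst e \<and> norm (chart_components e (\<gamma> t)) \<le> K"
      using compact_interval_in_chart[OF lu z e] by (elim exE conjE) (rule that)
    have \<delta>1: "0 < \<delta>1" "0 < K" "\<And>t. t \<in> {l..u} \<Longrightarrow> \<bar>t - z\<bar> \<le> \<delta>1 \<Longrightarrow> \<gamma> t \<in> fst e"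
      "\<And>t. t \<in> {l..u} \<Longrightarrow> \<bar>t - z\<bar> \<le> \<delta>1 \<Longrightarrow> norm (chart_components e (\<gamma> t)) \<le> K"
      using pos bd by auto
    obtain L where L: "0 < L" "\<And>(M::real^'n^'n) (N::real^'n^'n). norm (M ** N) \<le> norm M * norm N * L"
      using mul.pos_bounded by blast
    have KL: "0 < K * L" using \<delta>1 L by simp
    \<comment> \<open>This makes \<open>K * L\<close> times the length of the interval around \<open>z\<close> less than 1.\<close>
    define \<delta> where "\<delta> = min \<delta>1 (1 / (4 * (K * L)))"
    have \<delta>: "0 < \<delta>" "\<delta> \<le> \<delta>1" using \<delta>1 KL by (auto simp: \<delta>_def)
    define l' u' where "l' = max l (z - \<delta>)" and "u' = min u (z + \<delta>)"
    have sub: "{l'..u'} \<subseteq> {l..u}" by (auto simp: l'_def u'_def)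
    have near: "t \<in> {l..u} \<and> \<bar>t - z\<bar> \<le> \<delta>1" if "t \<in> {l'..u'}" for t using that \<delta> by (auto simp: l'_def u'_def)
    have ch: "e \<in> charts_at A (\<gamma> t)" if "t \<in> {l'..u'}" for t
      using \<delta>1(3)[of t] near[OF that] charts_atD[OF e] by (auto simp: charts_at_def)
    have small: "K * L * (u' - l') < 1"
    proof -
      have "K * L * (u' - l') \<le> K * L * (2 * (1 / (4 * (K * L))))"
        using KL by (intro mult_left_mono) (auto simp: l'_def u'_def \<delta>_def)
      also have "\<dots> < 1" using \<delta>1(2) L(1) by simp
      finally show ?thesis .
    qed
    define w where "w t = F t e - G t e" for t
    have w': "(w has_vector_derivative - (chart_components e (\<gamma> t) ** w t)) (at t within {l'..u'})" if t: "t \<in> {l'..u'}" for t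
    proof -
      have "t \<in> {l..u}" using t sub by blast
      then have "(w has_vector_derivative - (chart_components e (\<gamma> t) ** F t e) - - (chart_components e (\<gamma> t) ** G t e)) (at t within {l..u})"
        unfolding w_def[abs_def]
        by (intro has_vector_derivative_diff parallel_derivative[OF F] parallel_derivative[OF G] ch t)
      then show ?thesis
        using sub by (auto simp: w_def mul.diff_right intro: has_vector_derivative_within_subset)
    qed
    have w_bound: "norm (- (chart_components e (\<gamma> t) ** w t)) \<le> K * L * norm (w t)" if t: "t \<in> {l'..u'}" for t
    proof -
      have "norm (- (chart_components e (\<gamma> t) ** w t)) \<le> norm (chart_components e (\<gamma> t)) * norm (w t) * L" using L(2) by simp
      also have "\<dots> \<le> K * norm (w t) * L"
        using \<delta>1(4)[of t] near[OF t] L(1) by (intro mult_right_mono) auto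
      finally show ?thesis by (simp add: mult_ac)
    qed
    have step: "P q" if "p \<in> {l'..u'}" "q \<in> {l'..u'}" "P p" for p q
    proof -
      have "w p = 0" using that ch[of p] unfolding P_def w_def by simp
      then have "w q = 0"
        using zero_of_derivative_bound[OF w' w_bound that(1) _ _ small that(2)] KL by simp
      then show ?thesis using PI[of q e] that(2) sub ch[OF that(2)] by (auto simp: w_def)
    qed
    have "{l..u} \<inter> ball z \<delta> \<subseteq> {l'..u'}" by (auto simp: l'_def u'_def dist_real_def)
    then have "\<forall>x\<in>{l..u} \<inter> ball z \<delta>. \<forall>y\<in>{l..u} \<inter> ball z \<delta>. P x \<longrightarrow> P y" using step by blast
    moreover have "openin (top_of_set {l..u}) ({l..u} \<inter> ball z \<delta>)" by (simp add: openin_open_Int)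
    ultimately show "\<exists>T. openin (top_of_set {l..u}) T \<and> z \<in> T \<and> (\<forall>x\<in>T. \<forall>y\<in>T. P x \<longrightarrow> P y)"
      using \<delta>(1) z by (meson IntI centre_in_ball)
  qed (use x y PI in auto)
  then show ?thesis using y(2) unfolding P_def by blast
qed

text \<open>The interval \<open>J\<close> need not be compact. It is exhausted by compact intervals that contain \<open>a\<close>, and the
parallel frames on them become unique when their value at \<open>a\<close> is prescribed.\<close>

lemma parallel_frame_exists: "\<exists>F. parallel J F"
proof -
  obtain c0 where c0: "c0 \<in> charts_at A (\<gamma> a)" using chart_exists .
  have norm_ex: "\<exists>F. parallel {l..u} F \<and> F a c0 = mat 1" if lu: "{l..u} \<subseteq> J" "a \<in> {l..u}" for l u
  proof -
    obtain F where F: "parallel {l..u} F" using parallel_exists_compact[OF lu(1)] lu(2) by auto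
    obtain F' where "parallel {l..u} F'" "F' a c0 = mat 1"
      using parallel_normalize[OF F lu(2) c0, of "mat 1"] by (auto simp: invertible_def)
    then show ?thesis by blast
  qed
  have seg: "{min a s..max a s} \<subseteq> J" if "s \<in> J" for s
  proof
    fix r assume "r \<in> {min a s..max a s}"
    then have "a \<le> r \<and> r \<le> s \<or> s \<le> r \<and> r \<le> a" by (auto simp: min_def max_def split: if_splits)
    then show "r \<in> J" using interval(1,2) that unfolding is_interval_1 by blast
  qed
  have "\<exists>F. s \<in> J \<longrightarrow> parallel {min a s..max a s} F \<and> F a c0 = mat 1" for s
    using norm_ex[OF seg, of s] by auto
  then obtain \<Phi> where \<Phi>: "\<And>s. s \<in> J \<Longrightarrow> parallel {min a s..max a s} (\<Phi> s)"
    "\<And>s. s \<in> J \<Longrightarrow> \<Phi> s a c0 = mat 1" by metis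
  define E where "E s = \<Phi> s s" for s
  \<comment> \<open>On each compact interval that contains \<open>a\<close>, the diagonal choice \<open>E\<close> is the normalized frame of it.\<close>
  have E_eq: "E s d = F s d" if F: "parallel {l..u} F" "F a c0 = mat 1" and lu: "{l..u} \<subseteq> J" "a \<in> {l..u}"
    and s: "s \<in> {l..u}" "d \<in> charts_at A (\<gamma> s)" for F l u s d
  proof -
    have sJ: "s \<in> J" using s lu by blast
    have "parallel {min a s..max a s} F" using lu(2) s(1) by (intro parallel_subset[OF F(1)]) auto
    then show ?thesis
      unfolding E_def
      using parallel_unique[OF \<Phi>(1)[OF sJ], of F a c0 s d] seg[OF sJ] c0 \<Phi>(2)[OF sJ] F(2) s(2) by auto
  qed
  have "parallel J E"
    unfolding parallel_def frame_field_def
  proof (intro conjI ballI)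
    fix s c assume s: "s \<in> J" and c: "c \<in> charts_at A (\<gamma> s)"
    obtain l u where lu: "{l..u} \<subseteq> J" "s \<in> {l..u}" "a \<in> {l..u}" "at s within {l..u} = at s within J"
      "\<forall>\<^sub>F r in at s within J. r \<in> {l..u}"
      using interval_local_compact[OF interval s interval(2)] by metis
    obtain F where F: "parallel {l..u} F" "F a c0 = mat 1" using norm_ex lu(1,3) by blast
    have eq: "E s d = F s d" if "d \<in> charts_at A (\<gamma> s)" for d using E_eq[OF F lu(1,3,2) that] .
    show "invertible (E s c)" using parallel_invertible[OF F(1) lu(2) c] eq c by simp
    show "E s d = Jac c d (\<gamma> s) ** E s c" if "d \<in> charts_at A (\<gamma> s)" for d
      using parallel_transform_law[OF F(1) lu(2) c that] eq c that by simp
    have "\<forall>\<^sub>F t in at s within J. F t c = E t c"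
      using lu(5) eventually_in_chart[OF s c]
    proof eventually_elim
      case (elim t)
      then show ?case using E_eq[OF F lu(1,3), of t c] charts_atD[OF c] by (auto simp: charts_at_def)
    qed
    then show "((\<lambda>t. E t c) has_vector_derivative - (chart_components c (\<gamma> s) ** E s c)) (at s within J)"
      using has_vector_derivative_transform_eventually[of "\<lambda>t. F t c" _ s J "\<lambda>t. E t c"]
        parallel_derivative[OF F(1) lu(2) c] lu(4) s eq[OF c] by simp
  qed
  then show ?thesis by blast
qed

end

section \<open>Gluing local frame fields\<close>

text \<open>The weights \<open>b n * (\<Prod>i<n. 1 - b i)\<close> add up to 1 as soon as one of the \<open>b i\<close> is 1, and then all
later weights vanish. This gives a partition of unity that is locally finite where the cutoff
functions are equal to 1, without any refinement of the cover.\<close>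

lemma sum_partition_weights:
  fixes b :: "nat \<Rightarrow> real"
  shows "(\<Sum>n\<le>k. (\<Prod>i<n. 1 - b i) * b n) = 1 - (\<Prod>i\<le>k. 1 - b i)"
  by (induction k) (simp_all add: lessThan_Suc_atMost algebra_simps)

context C2_manifold
begin

text \<open>Cutoff functions are transported from the coordinate space. They extend by zero to C1 functions
on the whole manifold because their support is compact, hence closed in a Hausdorff space.\<close>

lemma chart_bump:
  assumes c: "c \<in> A" and B: "open B" "B \<subseteq> fst c" "p \<in> B"
  obtains \<beta> :: "'m \<Rightarrow> real" and Q K where "open Q" "p \<in> Q" "closed K" "K \<subseteq> B"
    "\<And>q. q \<in> Q \<Longrightarrow> \<beta> q = 1" "\<And>q. q \<notin> K \<Longrightarrow> \<beta> q = 0"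
    "\<And>d. d \<in> A \<Longrightarrow> C1_on (snd d ` fst d) (\<lambda>x. \<beta> (param d x))"
proof -
  define x0 where "x0 = snd c p"
  have pc: "p \<in> fst c" using B by blast
  have "open (snd c ` (B \<inter> fst c))" using open_coords_image[OF c B(1)] .
  moreover have "x0 \<in> snd c ` (B \<inter> fst c)" using B by (auto simp: x0_def)
  ultimately obtain r where r: "0 < r" "cball x0 r \<subseteq> snd c ` (B \<inter> fst c)"
    using open_contains_cball by blast
  obtain \<phi> :: "real^'n \<Rightarrow> real" where \<phi>: "C1_on UNIV \<phi>"
    "\<And>x. dist x x0 \<le> r / 2 \<Longrightarrow> \<phi> x = 1" "\<And>x. dist x x0 \<ge> 2 * (r / 2) \<Longrightarrow> \<phi> x = 0"
    using C1_bump[of "r / 2" x0] r by auto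
  define K where "K = param c ` cball x0 r"
  define Q where "Q = fst c \<inter> snd c -` ball x0 (r / 2)"
  define \<beta> where "\<beta> q = (if q \<in> fst c then \<phi> (snd c q) else 0)" for q
  have K0: "\<beta> q = 0" if "q \<notin> K" for q
  proof (cases "q \<in> fst c")
    case True
    then have "snd c q \<notin> cball x0 r" using that c unfolding K_def by (metis image_eqI param_coords)
    then show ?thesis using \<phi>(3)[of "snd c q"] by (simp add: \<beta>_def dist_commute)
  qed (simp add: \<beta>_def)
  have "continuous_on (cball x0 r) (param c)"
    using continuous_on_param[OF c] by (rule continuous_on_subset) (use r in blast)
  then have "compact K" unfolding K_def by (rule compact_continuous_image) simp
  then have K: "closed K" by (rule compact_imp_closed)
  have KO: "K \<subseteq> B"
  proof
    fix q assume "q \<in> K"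
    then obtain x where "x \<in> cball x0 r" "q = param c x" unfolding K_def by blast
    then obtain q' where "q' \<in> B \<inter> fst c" "q = param c (snd c q')" using r(2) by blast
    then show "q \<in> B" using c by simp
  qed
  show ?thesis
  proof (rule that[of Q K \<beta>])
    show "open Q" unfolding Q_def
      by (intro continuous_open_preimage continuous_on_coords open_chart c open_ball)
    show "p \<in> Q" using pc r by (simp add: Q_def x0_def)
    show "\<beta> q = 1" if "q \<in> Q" for q
      using that \<phi>(2)[of "snd c q"] by (simp add: Q_def \<beta>_def dist_commute)
    show "C1_on (snd d ` fst d) (\<lambda>x. \<beta> (param d x))" if d: "d \<in> A" for d
    proof (rule C1_on_local)
      fix x assume "x \<in> snd d ` fst d"
      then obtain q where q: "q \<in> fst d" "x = snd d q" by blast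
      show "\<exists>N. open N \<and> x \<in> N \<and> C1_on N (\<lambda>x. \<beta> (param d x))"
      proof (cases "q \<in> fst c")
        case True
        let ?N = "snd d ` (fst c \<inter> fst d)"
        have N: "open ?N" by (intro open_coords_image d open_chart c)
        have "C2_on (snd d ` (fst d \<inter> fst c)) (snd c \<circ> param d)"
          using atlas c d by (auto simp: C2_atlas_def)
        then have "C1_on ?N (snd c \<circ> param d)" using C2_on_imp_C1_on by (simp add: Int_commute)
        then have "C1_on ?N (\<lambda>x. \<phi> ((snd c \<circ> param d) x))"
          by (rule C1_on_compose[OF _ \<phi>(1)]) auto
        then have "C1_on ?N (\<lambda>x. \<beta> (param d x))"
          by (rule C1_on_cong[OF _ N]) (use d in \<open>auto simp: \<beta>_def\<close>)
        then show ?thesis using N q True by blast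
      next
        case False
        let ?N = "snd d ` (- K \<inter> fst d)"
        have N: "open ?N" using K d by (intro open_coords_image) auto
        have "C1_on ?N (\<lambda>x. \<beta> (param d x))"
          by (rule C1_on_cong[OF C1_on_const[of _ 0] N]) (use d K0 in auto)
        moreover have "q \<notin> K" using False KO B by blast
        ultimately show ?thesis using N q by blast
      qed
    qed
  qed (use K KO K0 in auto)
qed

text \<open>A field of matrices given near \<open>p\<close> in the coordinates of one chart is cut off, so that the result is
defined on the whole manifold and obeys the transformation law of a tuple of vector fields
everywhere.\<close>

lemma frame_piece:
  assumes c: "c \<in> A" and B: "open B" "B \<subseteq> fst c" "p \<in> B"
    and e: "C1_on (snd c ` B) (\<lambda>x. e (param c x))"
  obtains \<beta> :: "'m \<Rightarrow> real" and Q and H :: "'m \<Rightarrow> ('m, 'n) chart \<Rightarrow> real^'n^'n" where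
    "open Q" "p \<in> Q" "\<And>q. q \<in> Q \<Longrightarrow> \<beta> q = 1"
    "\<And>d. d \<in> A \<Longrightarrow> C1_on (snd d ` fst d) (\<lambda>x. \<beta> (param d x))"
    "\<And>d. d \<in> A \<Longrightarrow> C1_on (snd d ` fst d) (\<lambda>x. H (param d x) d)"
    "\<And>q d d'. d \<in> charts_at A q \<Longrightarrow> d' \<in> charts_at A q \<Longrightarrow> H q d' = Jac d d' q ** H q d"
    "\<And>q d. q \<in> B \<Longrightarrow> H q d = \<beta> q *\<^sub>R (Jac c d q ** e q)" "\<And>q d. q \<notin> B \<Longrightarrow> H q d = 0 \<and> \<beta> q = 0"
proof -
  interpret mul: bounded_bilinear "(**) :: real^'n^'n \<Rightarrow> real^'n^'n \<Rightarrow> real^'n^'n"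
    by (rule bounded_bilinear_matrix_mul)
  obtain \<beta> :: "'m \<Rightarrow> real" and Q K where b: "open Q" "p \<in> Q" "closed K" "K \<subseteq> B"
    "\<And>q. q \<in> Q \<Longrightarrow> \<beta> q = 1" "\<And>q. q \<notin> K \<Longrightarrow> \<beta> q = 0"
    "\<And>d. d \<in> A \<Longrightarrow> C1_on (snd d ` fst d) (\<lambda>x. \<beta> (param d x))"
    using chart_bump[OF c B] by metis
  define H where "H q d = \<beta> q *\<^sub>R (Jac c d q ** e q)" for q d
  have H0: "H q d = 0" if "q \<notin> K" for q d using b(6)[OF that] by (simp add: H_def)
  show ?thesis
  proof (rule that[of Q \<beta> H])
    fix d assume d: "d \<in> A"
    show "C1_on (snd d ` fst d) (\<lambda>x. H (param d x) d)"
    proof (rule C1_on_local)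
      fix x assume "x \<in> snd d ` fst d"
      then obtain q where q: "q \<in> fst d" "x = snd d q" by blast
      show "\<exists>N. open N \<and> x \<in> N \<and> C1_on N (\<lambda>x. H (param d x) d)"
      proof (cases "q \<in> B")
        case True
        let ?N = "snd d ` (B \<inter> fst d)"
        have N: "open ?N" by (intro open_coords_image d B)
        have "C2_on (snd d ` (fst d \<inter> fst c)) (snd c \<circ> param d)"
          using atlas c d by (auto simp: C2_atlas_def)
        then have "C1_on (snd d ` (fst d \<inter> fst c)) (\<lambda>x. snd c (param d x))"
          using C2_on_imp_C1_on by (simp add: o_def)
        then have "C1_on ?N (\<lambda>x. snd c (param d x))" by (rule C1_on_subset) (use B in auto)
        then have "C1_on ?N (\<lambda>x. e (param c (snd c (param d x))))"
          by (rule C1_on_compose[OF _ e]) (use d in auto)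
        then have "C1_on ?N (\<lambda>x. e (param d x))"
          by (rule C1_on_cong[OF _ N]) (use c d B in auto)
        moreover have "C1_on ?N (\<lambda>x. Jac c d (param d x))"
          using C1_on_Jac[OF c d d] by (rule C1_on_subset) (use B in auto)
        moreover have "C1_on ?N (\<lambda>x. \<beta> (param d x))"
          using b(7)[OF d] by (rule C1_on_subset) auto
        ultimately have "C1_on ?N (\<lambda>x. H (param d x) d)"
          unfolding H_def by (intro C1_on_scaleR C1_on_matrix_mul)
        then show ?thesis using N q True by blast
      next
        case False
        let ?N = "snd d ` (- K \<inter> fst d)"
        have N: "open ?N" using b(3) d by (intro open_coords_image) auto
        have "C1_on ?N (\<lambda>x. H (param d x) d)"
          by (rule C1_on_cong[OF C1_on_const[of _ 0] N]) (use d H0[of _ d] in auto)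
        moreover have "q \<notin> K" using False b(4) by blast
        ultimately show ?thesis using N q by blast
      qed
    qed
  next
    fix q d d' assume d: "d \<in> charts_at A q" and d': "d' \<in> charts_at A q"
    show "H q d' = Jac d d' q ** H q d"
    proof (cases "q \<in> K")
      case True
      then have "c \<in> charts_at A q" using b(4) B(2) c by (auto simp: charts_at_def)
      then show ?thesis
        using Jac_cocycle[OF _ d d', of c] by (simp add: H_def mul.scaleR_right matrix_mul_assoc)
    next
      case False
      then show ?thesis using H0 by (simp add: mul.zero_right)
    qed
  next
    show "H q d = 0 \<and> \<beta> q = 0" if "q \<notin> B" for q d using that b(4,6) H0 by blast
  qed (use b H_def in auto)
qed

text \<open>The pieces are added with the weights \<open>\<Prod>i<n. 1 - \<beta> i q\<close>; the factor \<open>\<beta> n q\<close> of the partition of unity is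
already contained in \<open>H n\<close>. On \<open>Q k\<close> the terms after the \<open>k\<close>-th vanish, so the sum is C1 there.
Where all pieces are multiples \<open>\<beta> n q\<close> of one matrix, the sum is this matrix.\<close>

lemma glue_frame_pieces:
  fixes Q :: "nat \<Rightarrow> 'm set" and \<beta> :: "nat \<Rightarrow> 'm \<Rightarrow> real" and H :: "nat \<Rightarrow> 'm \<Rightarrow> ('m, 'n) chart \<Rightarrow> real^'n^'n"
  assumes Q: "\<And>n. open (Q n)" and one: "\<And>n q. q \<in> Q n \<Longrightarrow> \<beta> n q = 1"
    and \<beta>: "\<And>n d. d \<in> A \<Longrightarrow> C1_on (snd d ` fst d) (\<lambda>x. \<beta> n (param d x))"
    and H: "\<And>n d. d \<in> A \<Longrightarrow> C1_on (snd d ` fst d) (\<lambda>x. H n (param d x) d)"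
    and law: "\<And>n q d d'. d \<in> charts_at A q \<Longrightarrow> d' \<in> charts_at A q \<Longrightarrow> H n q d' = Jac d d' q ** H n q d"
  obtains M :: "'m \<Rightarrow> ('m, 'n) chart \<Rightarrow> real^'n^'n" where
    "\<And>d. d \<in> A \<Longrightarrow> C1_on (snd d ` ((\<Union>n. Q n) \<inter> fst d)) (\<lambda>x. M (param d x) d)"
    "\<And>q d d'. d \<in> charts_at A q \<Longrightarrow> d' \<in> charts_at A q \<Longrightarrow> M q d' = Jac d d' q ** M q d"
    "\<And>q d N. q \<in> (\<Union>n. Q n) \<Longrightarrow> (\<And>n. H n q d = \<beta> n q *\<^sub>R N) \<Longrightarrow> M q d = N"
proof -
  interpret mul: bounded_bilinear "(**) :: real^'n^'n \<Rightarrow> real^'n^'n \<Rightarrow> real^'n^'n"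
    by (rule bounded_bilinear_matrix_mul)
  define R where "R n q = (\<Prod>i<n. 1 - \<beta> i q)" for n q
  define M where "M q d = (\<Sum>n\<le>(LEAST n. q \<in> Q n). R n q *\<^sub>R H n q d)" for q d
  have R0: "R n q = 0" if "q \<in> Q k" "k < n" for n k q
    unfolding R_def using that one by (intro prod_zero) auto
  \<comment> \<open>Any \<open>Q k\<close> that contains \<open>q\<close> can replace the first one, so the number of terms is constant on \<open>Q k\<close>.\<close>
  have M_eq: "M q d = (\<Sum>n\<le>k. R n q *\<^sub>R H n q d)" if "q \<in> Q k" for q d k
  proof -
    have L: "(LEAST n. q \<in> Q n) \<le> k" "q \<in> Q (LEAST n. q \<in> Q n)"
      using that by (auto intro: Least_le LeastI)
    show ?thesis unfolding M_def
      by (rule sum.mono_neutral_left) (use L R0[OF L(2)] in auto)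
  qed
  show ?thesis
  proof (rule that[of M])
    fix d assume d: "d \<in> A"
    show "C1_on (snd d ` ((\<Union>n. Q n) \<inter> fst d)) (\<lambda>x. M (param d x) d)"
    proof (rule C1_on_local)
      fix x assume "x \<in> snd d ` ((\<Union>n. Q n) \<inter> fst d)"
      then obtain q k where q: "q \<in> Q k" "q \<in> fst d" "x = snd d q" by blast
      let ?N = "snd d ` (Q k \<inter> fst d)"
      have N: "open ?N" by (intro open_coords_image d Q)
      have sub: "?N \<subseteq> snd d ` fst d" by auto
      have "C1_on ?N (\<lambda>x. \<Sum>n\<le>k. R n (param d x) *\<^sub>R H n (param d x) d)"
        unfolding R_def
        by (intro C1_on_sum C1_on_scaleR C1_on_prod C1_on_diff C1_on_const
            C1_on_subset[OF \<beta>[OF d] sub] C1_on_subset[OF H[OF d] sub])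
      then have "C1_on ?N (\<lambda>x. M (param d x) d)"
        by (rule C1_on_cong[OF _ N]) (use d M_eq[of _ k d] in auto)
      then show "\<exists>N. open N \<and> x \<in> N \<and> C1_on N (\<lambda>x. M (param d x) d)" using N q by blast
    qed
  next
    fix q d d' assume "d \<in> charts_at A q" "d' \<in> charts_at A q"
    then show "M q d' = Jac d d' q ** M q d"
      using law[of d q d'] by (simp add: M_def mul.sum_right mul.scaleR_right)
  next
    fix q d N assume q: "q \<in> (\<Union>n. Q n)" and N: "\<And>n. H n q d = \<beta> n q *\<^sub>R N"
    obtain k where k: "q \<in> Q k" using q by blast
    have "M q d = (\<Sum>n\<le>k. R n q * \<beta> n q) *\<^sub>R N"
      by (simp add: M_eq[OF k] N scaleR_sum_left)
    also have "(\<Sum>n\<le>k. R n q * \<beta> n q) = 1 - R (Suc k) q"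
      unfolding R_def by (simp add: sum_partition_weights lessThan_Suc_atMost)
    finally show "M q d = N" using R0[OF k, of "Suc k"] by simp
  qed
qed

end

section \<open>Bases with vanishing components\<close>

context S_derivation_on_path
begin

text \<open>For a parallel frame the derivative, \<open>- W F\<close>, cancels the algebraic term \<open>W F\<close>. The frame may be given by any \<open>M\<close> that agrees with
\<open>F\<close> in the charts around the points of the path, which covers both the basis along the path and the
restriction of a basis in a neighbourhood.\<close>

lemma parallel_frame_annihilated:
  assumes F: "parallel J F" and s: "s \<in> J" and c: "c \<in> charts_at A (\<gamma> s)"
    and M: "\<And>t d. t \<in> J \<Longrightarrow> d \<in> charts_at A (\<gamma> t) \<Longrightarrow> M t d = F t d"
  shows "S_derivation_along J \<gamma> S X (\<lambda>t. frame_vector (M t) j) s c [i] [] = 0"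
proof -
  have "\<forall>\<^sub>F t in at s within J. F t c = M t c"
  proof -
    have "\<forall>\<^sub>F t in at s within J. t \<in> J" by (simp add: eventually_at_filter)
    then show ?thesis
      using eventually_in_chart[OF s c]
    proof eventually_elim
      case (elim t)
      then show ?case using M[of t c] charts_atD[OF c] by (simp add: charts_at_def)
    qed
  qed
  then have "((\<lambda>t. M t c) has_vector_derivative - (chart_components c (\<gamma> s) ** F s c)) (at s within J)"
    by (intro has_vector_derivative_transform_eventually[OF parallel_derivative[OF F s c]] s M[OF s c, symmetric])
  then have "((\<lambda>t. M t c $ i $ j) has_vector_derivative (- (chart_components c (\<gamma> s) ** F s c)) $ i $ j) (at s within J)"
    by (intro bounded_linear.has_vector_derivative[OF bounded_linear_vec_nth])
  then have "vector_derivative (\<lambda>t. frame_vector (M t) j c [i] []) (at s within J) =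
      (- (chart_components c (\<gamma> s) ** F s c)) $ i $ j"
    unfolding frame_vector_def
    using vector_derivative_within[OF at_within_J_nontrivial[OF s]] by (simp add: fun_eq_iff)
  moreover have "(chart_components c (\<gamma> s) ** F s c) $ i $ j = (chart_components c (\<gamma> s) *v column j (F s c)) $ i"
    by (simp add: column_def matrix_matrix_mult_def matrix_vector_mult_def)
  ultimately show ?thesis
    by (simp add: S_derivation_along_vector vector_coords_frame_vector M[OF s c])
qed

lemma continuous_on_parallel:
  assumes F: "parallel K F" and c: "c \<in> A"
  shows "continuous_on {t\<in>K. \<gamma> t \<in> fst c} (\<lambda>t. F t c)"
proof (rule continuous_on_vector_derivative)
  fix t assume "t \<in> {t\<in>K. \<gamma> t \<in> fst c}"
  then show "((\<lambda>t. F t c) has_vector_derivative - (chart_components c (\<gamma> t) ** F t c)) (at t within {t\<in>K. \<gamma> t \<in> fst c})"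
    using c by (intro has_vector_derivative_within_subset[OF parallel_derivative[OF F]]) (auto simp: charts_at_def)
qed

lemma continuous_on_parallel_derivative:
  assumes F: "parallel J F" and c: "c \<in> A"
  shows "continuous_on {t\<in>J. \<gamma> t \<in> fst c} (\<lambda>t. - (chart_components c (\<gamma> t) ** F t c))"
  by (intro continuous_on_minus bounded_bilinear.continuous_on[OF bounded_bilinear_matrix_mul]
      continuous_on_chart_components continuous_on_parallel F c)

lemma normal_basis_along_path:
  "\<exists>E. C1_basis_along A J \<gamma> E \<and>
    (\<forall>s\<in>J. has_components A (\<gamma> s) (\<lambda>j. E j s) (\<lambda>j. S_derivation_along J \<gamma> S X (E j) s) 0)"
proof -
  obtain F where F: "parallel J F" using parallel_frame_exists by blast
  define E where "E j s = frame_vector (F s) j" for j s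
  have law: "F s d = Jac c d (\<gamma> s) ** F s c"
    if "s \<in> J" "c \<in> charts_at A (\<gamma> s)" "d \<in> charts_at A (\<gamma> s)" for s c d
    using parallel_transform_law[OF F that] .
  have "C1_tensor_along A 1 0 J \<gamma> (E j)" for j
    unfolding C1_tensor_along_def
  proof (intro conjI ballI allI impI)
    show "tensor_at A 1 0 (\<gamma> s) (E j s)" if "s \<in> J" for s
      unfolding E_def by (rule tensor_at_frame_vector[OF law[OF that]])
    fix c :: "('m, 'n) chart" and I L :: "'n list" assume c: "c \<in> A" and "length I = 1" "length L = 0"
    have "((\<lambda>t. F t c $ hd I $ j) has_vector_derivative (- (chart_components c (\<gamma> t) ** F t c)) $ hd I $ j) (at t within J)"
      if "t \<in> {t\<in>J. \<gamma> t \<in> fst c}" for t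
      using that c
      by (intro bounded_linear.has_vector_derivative[OF bounded_linear_vec_nth] parallel_derivative[OF F])
         (auto simp: charts_at_def)
    then show "C1_curve_on J {t \<in> J. \<gamma> t \<in> fst c} (\<lambda>t. E j t c I L)"
      unfolding C1_curve_on_def E_def frame_vector_def
      using continuous_on_parallel_derivative[OF F c]
      by (intro exI[of _ "\<lambda>t. (- (chart_components c (\<gamma> t) ** F t c)) $ hd I $ j"] conjI ballI continuous_on_component)
  qed
  moreover have "basis_at A (\<gamma> s) (\<lambda>j. E j s)" if "s \<in> J" for s
    unfolding E_def using basis_at_frame_vector[OF law[OF that] parallel_invertible[OF F that]] .
  moreover have "has_components A (\<gamma> s) (\<lambda>j. E j s) (\<lambda>j. S_derivation_along J \<gamma> S X (E j) s) 0"
    if "s \<in> J" for s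
    unfolding has_components_def E_def using parallel_frame_annihilated[OF F that] by simp
  ultimately show ?thesis unfolding C1_basis_along_def by blast
qed

text \<open>In coordinates the path solves \<open>x' = f x\<close>, where \<open>f\<close> is differentiable at \<open>x0 = x s\<close>. If \<open>f x0 = 0\<close>, then
\<open>norm (f x) \<le> L * norm (x - x0)\<close> near \<open>x0\<close>, so \<open>x\<close> is constant near \<open>s\<close>, and the path is not injective.\<close>

lemma velocity_nonzero:
  assumes inj: "inj_on \<gamma> J" and s: "s \<in> J" and c: "c \<in> charts_at A (\<gamma> s)"
  shows "vector_coords (X (\<gamma> s)) c \<noteq> 0"
proof
  assume zero: "vector_coords (X (\<gamma> s)) c = 0"
  note mem = charts_atD[OF c]
  define x0 where "x0 = snd c (\<gamma> s)"
  define f where "f x = vector_coords (X (param c x)) c" for x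
  have f0: "f x0 = 0" using zero mem by (simp add: f_def x0_def)
  have df: "(f has_derivative (\<lambda>v. D_coords X c (\<gamma> s) *v v)) (at x0)"
    unfolding f_def[abs_def] x0_def
    using C1_vector_field_has_derivative[OF X(1) mem(1) \<gamma>_in_U[OF s] mem(2)] .
  obtain N where N: "\<And>v. norm (D_coords X c (\<gamma> s) *v v) \<le> norm v * N"
    using bounded_linear.bounded[OF has_derivative_bounded_linear[OF df]] by blast
  have "\<forall>e>0. \<exists>d>0. \<forall>y. norm (y - x0) < d \<longrightarrow> norm (f y - f x0 - D_coords X c (\<gamma> s) *v (y - x0)) \<le> e * norm (y - x0)"
    using df unfolding has_derivative_at_alt by blast
  then obtain \<delta> where \<delta>: "0 < \<delta>"
    "\<And>y. norm (y - x0) < \<delta> \<Longrightarrow> norm (f y - f x0 - D_coords X c (\<gamma> s) *v (y - x0)) \<le> 1 * norm (y - x0)"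
    using zero_less_one by blast
  define L where "L = \<bar>N\<bar> + 1"
  have L: "0 < L" by (simp add: L_def add_nonneg_pos)
  have f_bound: "norm (f y) \<le> L * norm (y - x0)" if "norm (y - x0) < \<delta>" for y
  proof -
    have "norm (f y) \<le> norm (D_coords X c (\<gamma> s) *v (y - x0)) + 1 * norm (y - x0)"
      using \<delta>(2)[OF that] f0 by (smt (verit) diff_zero norm_triangle_sub)
    also have "\<dots> \<le> norm (y - x0) * \<bar>N\<bar> + 1 * norm (y - x0)"
      using N[of "y - x0"] by (smt (verit) mult_left_mono norm_ge_zero)
    finally show ?thesis by (simp add: L_def algebra_simps)
  qed
  obtain l u where lu: "l < u" "{l..u} \<subseteq> J" "s \<in> {l..u}"
    using interval_local_compact[OF interval s s] by metis
  let ?x = "snd c \<circ> \<gamma>"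
  obtain \<epsilon>1 where \<epsilon>1: "0 < \<epsilon>1" "\<And>t. t \<in> {l..u} \<Longrightarrow> \<bar>t - s\<bar> \<le> \<epsilon>1 \<Longrightarrow> \<gamma> t \<in> fst c"
    using compact_interval_in_chart[OF lu(2,3) c] by blast
  have "continuous (at s within J) ?x"
    using coords_has_vector_derivative[OF s c] has_vector_derivative_continuous by blast
  then obtain \<epsilon>2 where \<epsilon>2: "0 < \<epsilon>2" "\<And>t. t \<in> J \<Longrightarrow> dist t s < \<epsilon>2 \<Longrightarrow> dist (?x t) (?x s) < \<delta>"
    using \<delta>(1) unfolding continuous_within_eps_delta by blast
  \<comment> \<open>The interval around \<open>s\<close> has length at most \<open>2 * \<epsilon>\<close>, which must be less than \<open>1 / L\<close>.\<close>
  define \<epsilon> where "\<epsilon> = min \<epsilon>1 (min (\<epsilon>2 / 2) (1 / (4 * L)))"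
  have \<epsilon>: "0 < \<epsilon>" "\<epsilon> \<le> \<epsilon>1" "\<epsilon> < \<epsilon>2" "L * (2 * \<epsilon>) < 1"
  proof -
    have "L * (2 * \<epsilon>) \<le> L * (2 * (1 / (4 * L)))" using L by (intro mult_left_mono) (auto simp: \<epsilon>_def)
    also have "\<dots> < 1" using L by simp
    finally show "L * (2 * \<epsilon>) < 1" .
  qed (use \<epsilon>1 \<epsilon>2 L in \<open>auto simp: \<epsilon>_def min_def\<close>)
  define l' u' where "l' = max l (s - \<epsilon>)" and "u' = min u (s + \<epsilon>)"
  have lt: "l' < u'" and sl: "s \<in> {l'..u'}" using lu \<epsilon>(1) by (auto simp: l'_def u'_def)
  have near: "t \<in> {l..u}" "t \<in> J" "\<gamma> t \<in> fst c" "norm (?x t - x0) < \<delta>" if "t \<in> {l'..u'}" for t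
  proof -
    have lt: "t \<in> {l..u}" and ts: "\<bar>t - s\<bar> \<le> \<epsilon>" using that by (auto simp: l'_def u'_def)
    then show "t \<in> {l..u}" "t \<in> J" using lu(2) by auto
    show "\<gamma> t \<in> fst c" using \<epsilon>1(2)[OF lt] ts \<epsilon>(2) by linarith
    show "norm (?x t - x0) < \<delta>"
      using \<epsilon>2(2)[of t] ts \<epsilon>(3) lt lu(2) by (auto simp: x0_def dist_norm)
  qed
  have const: "?x t - x0 = 0" if t: "t \<in> {l'..u'}" for t
  proof (rule zero_of_derivative_bound[where y="\<lambda>t. ?x t - x0" and y'="\<lambda>t. f (?x t)" and x=s and L=L])
    fix r assume r: "r \<in> {l'..u'}"
    have "(?x has_vector_derivative f (?x r)) (at r within J)"
      using coords_has_vector_derivative[of r c] near[OF r] mem by (simp add: f_def charts_at_def)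
    then have "(?x has_vector_derivative f (?x r)) (at r within {l'..u'})"
      by (rule has_vector_derivative_within_subset) (use near(2) in blast)
    from has_vector_derivative_diff[OF this has_vector_derivative_const[of x0]]
    show "((\<lambda>t. ?x t - x0) has_vector_derivative f (?x r)) (at r within {l'..u'})" by simp
    show "norm (f (?x r)) \<le> L * norm (?x r - x0)" using f_bound near(4)[OF r] by blast
  next
    have "L * (u' - l') \<le> L * (2 * \<epsilon>)" using L by (intro mult_left_mono) (auto simp: l'_def u'_def)
    then show "L * (u' - l') < 1" using \<epsilon>(4) by linarith
  qed (use sl t L in \<open>auto simp: x0_def\<close>)
  have "\<gamma> l' = \<gamma> u'"
  proof -
    have e: "l' \<in> {l'..u'}" "u' \<in> {l'..u'}" using lt by auto
    have "?x l' = ?x u'" using const[OF e(1)] const[OF e(2)] by simp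
    then show ?thesis using near(3)[OF e(1)] near(3)[OF e(2)] mem(1) by (metis comp_apply param_coords)
  qed
  then show False using inj near(2)[of l'] near(2)[of u'] lt by (auto dest: inj_onD)
qed

text \<open>Some coordinate of the velocity at \<open>s\<close> is not zero, so near \<open>s\<close> the frame \<open>F\<close> is a C1 function of the
corresponding coordinate of the point; this function serves as the extension. Continuity of \<open>g\<close>
is what makes the parameters \<open>t\<close> with \<open>\<gamma> t \<in> B\<close> close to \<open>s\<close>.\<close>

lemma local_extension:
  assumes hom: "homeomorphism J (\<gamma> ` J) \<gamma> g" and F: "parallel J F" and s: "s \<in> J"
  obtains c B e where "c \<in> A" "open B" "B \<subseteq> fst c" "\<gamma> s \<in> B" "C1_on (snd c ` B) (\<lambda>x. e (param c x))"
    "\<And>t. t \<in> J \<Longrightarrow> \<gamma> t \<in> B \<Longrightarrow> e (\<gamma> t) = F t c"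
proof -
  obtain c where c: "c \<in> charts_at A (\<gamma> s)" using chart_exists .
  note mem = charts_atD[OF c]
  have g: "g (\<gamma> t) = t" if "t \<in> J" for t using hom that by (simp add: homeomorphism_def)
  have inj: "inj_on \<gamma> J" using g by (metis inj_onI)
  obtain k where k: "vector_coords (X (\<gamma> s)) c $ k \<noteq> 0"
    using velocity_nonzero[OF inj s c] by (auto simp: vec_eq_iff)
  obtain l u where lu: "{l..u} \<subseteq> J" "s \<in> {l..u}" "\<forall>\<^sub>F r in at s within J. r \<in> {l..u}"
    using interval_local_compact[OF interval s s] by metis
  obtain \<epsilon>0 where \<epsilon>0: "0 < \<epsilon>0" "\<And>t. t \<in> J \<Longrightarrow> dist t s < \<epsilon>0 \<Longrightarrow> t \<in> {l..u}"
    using lu(2,3) unfolding eventually_at by metis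
  obtain \<epsilon>1 where \<epsilon>1: "0 < \<epsilon>1" "\<And>t. t \<in> {l..u} \<Longrightarrow> \<bar>t - s\<bar> \<le> \<epsilon>1 \<Longrightarrow> \<gamma> t \<in> fst c"
    using compact_interval_in_chart[OF lu(1,2) c] by blast
  define l' u' where "l' = max l (s - \<epsilon>1)" and "u' = min u (s + \<epsilon>1)"
  have sub: "t \<in> J \<and> \<gamma> t \<in> fst c" if "t \<in> {l'..u'}" for t
    using that lu(1) \<epsilon>1(2)[of t] by (auto simp: l'_def u'_def)
  have subJ: "{l'..u'} \<subseteq> J" and subT: "{l'..u'} \<subseteq> {t\<in>J. \<gamma> t \<in> fst c}" using sub by auto
  have sl: "s \<in> {l'..u'}" using lu(2) \<epsilon>1(1) by (auto simp: l'_def u'_def)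
  define x where "x t = snd c (\<gamma> t) $ k" for t
  define x' where "x' t = vector_coords (X (\<gamma> t)) c $ k" for t
  have dx: "(x has_vector_derivative x' t) (at t within {l'..u'})" if "t \<in> {l'..u'}" for t
  proof -
    have "((snd c \<circ> \<gamma>) has_vector_derivative vector_coords (X (\<gamma> t)) c) (at t within {l'..u'})"
      using sub[OF that] mem(1)
      by (intro has_vector_derivative_within_subset[OF coords_has_vector_derivative subJ]) (auto simp: charts_at_def)
    from bounded_linear.has_vector_derivative[OF bounded_linear_vec_nth this, of k]
    show ?thesis by (simp add: x_def[abs_def] x'_def o_def)
  qed
  have cx': "continuous_on {l'..u'} x'"
  proof -
    have "C1_on (snd c ` (U \<inter> fst c)) ((\<lambda>p. X p c [k] []) \<circ> param c)"
      using X(1) mem(1) unfolding C1_tensor_field_def by simp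
    then have "continuous_on (snd c ` (U \<inter> fst c)) ((\<lambda>p. X p c [k] []) \<circ> param c)"
      by (rule C1_on_imp_continuous_on)
    moreover have "continuous_on {l'..u'} (\<lambda>t. snd c (\<gamma> t))"
      by (rule continuous_on_compose2[OF continuous_on_coords[OF mem(1)] continuous_on_subset[OF continuous_\<gamma> subJ]])
         (use sub in auto)
    ultimately have "continuous_on {l'..u'} (\<lambda>t. ((\<lambda>p. X p c [k] []) \<circ> param c) (snd c (\<gamma> t)))"
      by (rule continuous_on_compose2) (use sub \<gamma>_in_U in auto)
    then show ?thesis
      by (rule continuous_on_eq) (use sub mem(1) in \<open>auto simp: x'_def vector_coords_def\<close>)
  qed
  have dy: "((\<lambda>t. F t c) has_vector_derivative - (chart_components c (\<gamma> t) ** F t c)) (at t within {l'..u'})"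
    if "t \<in> {l'..u'}" for t
    using sub[OF that] mem(1)
    by (intro has_vector_derivative_within_subset[OF parallel_derivative[OF F] subJ]) (auto simp: charts_at_def)
  obtain \<delta> W G where \<delta>: "0 < \<delta>" and W: "open W" "x s \<in> W" and G: "C1_on W G"
    "\<And>t. t \<in> {l'..u'} \<Longrightarrow> dist t s < \<delta> \<Longrightarrow> x t \<in> W \<and> G (x t) = F t c"
    using C1_function_of_monotone_coordinate[OF sl dx cx' _ dy
        continuous_on_subset[OF continuous_on_parallel_derivative[OF F mem(1)] subT]] k
    unfolding x'_def by (metis (no_types, lifting))
  define \<epsilon> where "\<epsilon> = min \<delta> (min \<epsilon>0 \<epsilon>1)"
  have \<epsilon>: "0 < \<epsilon>" using \<delta> \<epsilon>0 \<epsilon>1 by (simp add: \<epsilon>_def)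
  have "continuous_on (\<gamma> ` J) g" using hom by (simp add: homeomorphism_def)
  then obtain B1 where B1: "open B1" "g -` ball s \<epsilon> \<inter> \<gamma> ` J = B1 \<inter> \<gamma> ` J"
    unfolding continuous_on_open_invariant using open_ball by metis
  have B1_near: "dist t s < \<epsilon>" if "t \<in> J" "\<gamma> t \<in> B1" for t
  proof -
    have "\<gamma> t \<in> g -` ball s \<epsilon>" using B1(2) that by blast
    then show ?thesis using g[OF that(1)] by (simp add: dist_commute)
  qed
  have sB1: "\<gamma> s \<in> B1" using B1(2) s g[OF s] \<epsilon> by auto
  define B where "B = B1 \<inter> (fst c \<inter> (\<lambda>p. snd c p $ k) -` W)"
  have "open (fst c \<inter> (\<lambda>p. snd c p $ k) -` W)"
    by (intro continuous_open_preimage continuous_on_component continuous_on_coords open_chart mem W)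
  then have oB: "open B" using B1(1) unfolding B_def by blast
  have oB': "open (snd c ` B)"
    using open_coords_image[OF mem(1) oB] by (simp add: B_def Int_assoc Int_left_commute)
       (simp add: Int_commute Int_left_commute)
  show ?thesis
  proof (rule that[of c B "\<lambda>p. G (snd c p $ k)"])
    show "\<gamma> s \<in> B" using sB1 mem W by (simp add: B_def x_def)
    have "C1_on (snd c ` B) (\<lambda>x. G (x $ k))"
      by (rule C1_on_compose[OF C1_on_vec_nth[OF C1_on_bounded_linear[OF bounded_linear_ident]] G(1)])
         (auto simp: B_def)
    then show "C1_on (snd c ` B) (\<lambda>x. G (snd c (param c x) $ k))"
      by (rule C1_on_cong[OF _ oB']) (use mem in \<open>auto simp: B_def\<close>)
    fix t assume t: "t \<in> J" "\<gamma> t \<in> B"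
    then have ts: "dist t s < \<epsilon>" using B1_near by (simp add: B_def)
    then have "t \<in> {l'..u'}"
      using \<epsilon>0(2)[OF t(1)] by (auto simp: l'_def u'_def \<epsilon>_def dist_real_def)
    then show "G (snd c (\<gamma> t) $ k) = F t c" using G(2)[of t] ts by (simp add: \<epsilon>_def x_def)
  qed (use oB mem in \<open>auto simp: B_def\<close>)
qed

text \<open>The glued field of matrices equals the parallel frame on the path, so it is invertible in a
neighbourhood \<open>V\<close>, and there its columns form the basis.\<close>

lemma normal_basis_near_embedded_path:
  assumes hom: "homeomorphism J (\<gamma> ` J) \<gamma> g"
  shows "\<exists>V E. open V \<and> \<gamma> ` J \<subseteq> V \<and> V \<subseteq> U \<and> C1_basis_on A V E \<and>
    (\<forall>s\<in>J. has_components A (\<gamma> s) (\<lambda>j. E j (\<gamma> s)) (\<lambda>j. S_derivation S X (E j) (\<gamma> s)) 0)"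
proof -
  obtain F where F: "parallel J F" using parallel_frame_exists by blast
  define piece where "piece Q \<beta> H \<longleftrightarrow> open Q \<and> (\<forall>q\<in>Q. \<beta> q = 1) \<and>
      (\<forall>d\<in>A. C1_on (snd d ` fst d) (\<lambda>x. \<beta> (param d x))) \<and>
      (\<forall>d\<in>A. C1_on (snd d ` fst d) (\<lambda>x. H (param d x) d)) \<and>
      (\<forall>q. \<forall>d\<in>charts_at A q. \<forall>d'\<in>charts_at A q. H q d' = Jac d d' q ** H q d) \<and>
      (\<forall>t\<in>J. \<forall>d\<in>charts_at A (\<gamma> t). H (\<gamma> t) d = \<beta> (\<gamma> t) *\<^sub>R F t d)"
    for Q \<beta> and H :: "'m \<Rightarrow> ('m, 'n) chart \<Rightarrow> real^'n^'n"
  have ex: "\<exists>Q \<beta> H. piece Q \<beta> H \<and> \<gamma> s \<in> Q" if s: "s \<in> J" for s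
  proof -
    obtain c B e where e: "c \<in> A" "open B" "B \<subseteq> fst c" "\<gamma> s \<in> B" "C1_on (snd c ` B) (\<lambda>x. e (param c x))"
      "\<And>t. t \<in> J \<Longrightarrow> \<gamma> t \<in> B \<Longrightarrow> e (\<gamma> t) = F t c"
      using local_extension[OF hom F s] by metis
    obtain \<beta> Q H where H: "open Q" "\<gamma> s \<in> Q" "\<And>q. q \<in> Q \<Longrightarrow> \<beta> q = 1"
      "\<And>d. d \<in> A \<Longrightarrow> C1_on (snd d ` fst d) (\<lambda>x. \<beta> (param d x))"
      "\<And>d. d \<in> A \<Longrightarrow> C1_on (snd d ` fst d) (\<lambda>x. H (param d x) d)"
      "\<And>q d d'. d \<in> charts_at A q \<Longrightarrow> d' \<in> charts_at A q \<Longrightarrow> H q d' = Jac d d' q ** H q d"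
      and in_B: "\<And>q d. q \<in> B \<Longrightarrow> H q d = \<beta> q *\<^sub>R (Jac c d q ** e q)"
      and off_B: "\<And>q d. q \<notin> B \<Longrightarrow> H q d = 0 \<and> \<beta> q = 0"
      by (rule frame_piece[OF e(1-5)], rule that)
    have "H (\<gamma> t) d = \<beta> (\<gamma> t) *\<^sub>R F t d" if t: "t \<in> J" and d: "d \<in> charts_at A (\<gamma> t)" for t d
    proof (cases "\<gamma> t \<in> B")
      case True
      then have "c \<in> charts_at A (\<gamma> t)" using e(1,3) by (auto simp: charts_at_def)
      from parallel_transform_law[OF F t this d] show ?thesis using in_B[OF True] e(6)[OF t True] by simp
    next
      case False
      then show ?thesis using off_B[OF False, of d] by simp
    qed
    then have "piece Q \<beta> H" unfolding piece_def using H by blast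
    then show ?thesis using H(2) by blast
  qed
  obtain \<F> where \<F>: "\<F> \<subseteq> {Q. \<exists>\<beta> H. piece Q \<beta> H}" "countable \<F>" "\<Union>\<F> = \<Union>{Q. \<exists>\<beta> H. piece Q \<beta> H}"
    by (rule Lindelof[of "{Q. \<exists>\<beta> H. piece Q \<beta> H}"]) (auto simp: piece_def)
  have "\<F> \<noteq> {}" using \<F>(3) ex[OF interval(2)] by blast
  then have range: "range (from_nat_into \<F>) = \<F>" using \<F>(2) by (rule range_from_nat_into)
  define Q where "Q = from_nat_into \<F>"
  have "\<forall>n. \<exists>\<beta> H. piece (Q n) \<beta> H" using range \<F>(1) unfolding Q_def by blast
  then obtain \<beta> where "\<forall>n. \<exists>H. piece (Q n) (\<beta> n) H" by (rule choice[THEN exE])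
  then obtain H where "\<forall>n. piece (Q n) (\<beta> n) (H n)" by (rule choice[THEN exE])
  then have P: "piece (Q n) (\<beta> n) (H n)" for n by blast
  have cover: "\<gamma> s \<in> (\<Union>n. Q n)" if "s \<in> J" for s
  proof -
    obtain Q' \<beta>' H' where Q': "piece Q' \<beta>' H'" "\<gamma> s \<in> Q'" using ex[OF \<open>s \<in> J\<close>] by blast
    then have "Q' \<in> {Q. \<exists>\<beta> H. piece Q \<beta> H}" by blast
    then have "\<gamma> s \<in> \<Union>\<F>" using Q'(2) \<F>(3) by blast
    then show ?thesis using range by (simp add: Q_def)
  qed
  obtain M :: "'m \<Rightarrow> ('m, 'n) chart \<Rightarrow> real^'n^'n" where
    M: "\<And>d. d \<in> A \<Longrightarrow> C1_on (snd d ` ((\<Union>n. Q n) \<inter> fst d)) (\<lambda>x. M (param d x) d)"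
    and law: "\<And>q d d'. d \<in> charts_at A q \<Longrightarrow> d' \<in> charts_at A q \<Longrightarrow> M q d' = Jac d d' q ** M q d"
    and val: "\<And>q d N. q \<in> (\<Union>n. Q n) \<Longrightarrow> (\<And>n. H n q d = \<beta> n q *\<^sub>R N) \<Longrightarrow> M q d = N"
    by (rule glue_frame_pieces[of Q \<beta> H]) (use P in \<open>unfold piece_def, blast+\<close>)
  have MF: "M (\<gamma> t) d = F t d" if "t \<in> J" "d \<in> charts_at A (\<gamma> t)" for t d
    using val[OF cover[OF that(1)]] P that unfolding piece_def by blast
  define V where "V = {p \<in> U \<inter> (\<Union>n. Q n). \<forall>d\<in>charts_at A p. invertible (M p d)}"
  have oQ: "open (\<Union>n. Q n)" using P unfolding piece_def by blast
  have "open V"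
  proof (subst open_subopen, rule ballI)
    fix p assume p: "p \<in> V"
    obtain d where d: "d \<in> charts_at A p" using chart_exists .
    note mem = charts_atD[OF d]
    define T where "T = (\<Union>n. Q n) \<inter> fst d"
    have "continuous_on T (snd d)"
      using continuous_on_coords[OF mem(1)] by (rule continuous_on_subset) (auto simp: T_def)
    then have "continuous_on T (\<lambda>q. M (param d (snd d q)) d)"
      by (rule continuous_on_compose2[OF C1_on_imp_continuous_on[OF M[OF mem(1)]]]) (auto simp: T_def)
    then have "continuous_on T (\<lambda>q. M q d)"
      by (rule continuous_on_eq) (use mem(1) in \<open>auto simp: T_def\<close>)
    then have "open (T \<inter> (\<lambda>q. det (M q d)) -` (- {0}))"
      using oQ open_chart[OF mem(1)] by (intro continuous_open_preimage continuous_on_det) (auto simp: T_def)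
    then have "open (U \<inter> (T \<inter> (\<lambda>q. det (M q d)) -` (- {0})))" using nbhd(1) by blast
    moreover have "U \<inter> (T \<inter> (\<lambda>q. det (M q d)) -` (- {0})) \<subseteq> V"
    proof
      fix q assume q: "q \<in> U \<inter> (T \<inter> (\<lambda>q. det (M q d)) -` (- {0}))"
      then have dq: "d \<in> charts_at A q" and inv: "invertible (M q d)"
        using mem(1) by (auto simp: T_def charts_at_def invertible_det_nz)
      have "invertible (M q d')" if "d' \<in> charts_at A q" for d'
        unfolding law[OF dq that] by (intro invertible_mult Jac_invertible dq that inv)
      then show "q \<in> V" using q by (auto simp: V_def T_def)
    qed
    moreover have "p \<in> U \<inter> (T \<inter> (\<lambda>q. det (M q d)) -` (- {0}))"
      using p d mem by (auto simp: V_def T_def invertible_det_nz)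
    ultimately show "\<exists>T. open T \<and> p \<in> T \<and> T \<subseteq> V" by blast
  qed
  have \<gamma>V: "\<gamma> ` J \<subseteq> V"
    using cover \<gamma>_in_U MF parallel_invertible[OF F] by (auto simp: V_def)
  define E where "E j p = frame_vector (M p) j" for j p
  have field: "C1_vector_field A V (E j)" for j
    unfolding C1_tensor_field_def
  proof (intro conjI ballI allI impI)
    show "tensor_at A 1 0 p (E j p)" for p
      unfolding E_def by (rule tensor_at_frame_vector[OF law])
    fix c :: "('m, 'n) chart" and I L :: "'n list" assume c: "c \<in> A" and "length I = 1" "length L = 0"
    have "C1_on (snd c ` (V \<inter> fst c)) (\<lambda>x. M (param c x) c)"
      using M[OF c] by (rule C1_on_subset) (auto simp: V_def)
    then show "C1_on (snd c ` (V \<inter> fst c)) ((\<lambda>p. E j p c I L) \<circ> param c)"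
      unfolding E_def frame_vector_def o_def by (intro C1_on_vec_nth)
  qed
  have "basis_at A p (\<lambda>j. E j p)" if "p \<in> V" for p
    unfolding E_def using that by (intro basis_at_frame_vector law) (auto simp: V_def)
  then have "C1_basis_on A V E" using field by (simp add: C1_basis_on_def)
  moreover have "has_components A (\<gamma> s) (\<lambda>j. E j (\<gamma> s)) (\<lambda>j. S_derivation S X (E j) (\<gamma> s)) 0"
    if s: "s \<in> J" for s
  proof -
    have "S_derivation S X (E j) (\<gamma> s) c [i] [] = 0" if c: "c \<in> charts_at A (\<gamma> s)" for c i j
    proof -
      have "S_derivation_along J \<gamma> S X (\<lambda>t. E j (\<gamma> t)) s c [i] [] = S_derivation S X (E j) (\<gamma> s) c [i] []"
        using S_derivation_along_restrict[OF atlas interval path \<open>open V\<close> \<gamma>V X(2) field s c] by simp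
      moreover have "S_derivation_along J \<gamma> S X (\<lambda>t. E j (\<gamma> t)) s c [i] [] = 0"
        unfolding E_def using parallel_frame_annihilated[OF F s c MF] .
      ultimately show ?thesis by simp
    qed
    then show ?thesis by (simp add: has_components_def)
  qed
  moreover have "V \<subseteq> U" by (auto simp: V_def)
  ultimately show ?thesis using \<open>open V\<close> \<gamma>V by blast
qed

end

theorem proposition4:
  fixes A :: "('m::{t2_space,second_countable_topology}, 'n::finite) chart set"
    and J :: "real set" and a b :: real and \<gamma> :: "real \<Rightarrow> 'm" and U :: "'m set"
    and S :: "('m \<Rightarrow> ('m, 'n) tensor) \<Rightarrow> 'm \<Rightarrow> ('m, 'n) tensor"
    and X :: "'m \<Rightarrow> ('m, 'n) tensor"
  assumes manifold: "C2_atlas A"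
    and interval: "is_interval J" "a \<in> J" "b \<in> J" "a < b"
    and path: "C1_path A J \<gamma>"
    and nbhd: "open U" "\<gamma> ` J \<subseteq> U"
    and S: "\<And>Y. C1_vector_field A U Y \<Longrightarrow> C0_tensor_field A 1 1 U (S Y)"
    and X: "C1_vector_field A U X" "reduces_to_tangent A J \<gamma> X"
  shows "(\<exists>E. C1_basis_along A J \<gamma> E \<and>
            (\<forall>s\<in>J. has_components A (\<gamma> s) (\<lambda>j. E j s)
                     (\<lambda>j. S_derivation_along J \<gamma> S X (E j) s) 0)) \<and>
         ((\<exists>g. homeomorphism J (\<gamma> ` J) \<gamma> g) \<longrightarrow>
          (\<exists>V E. open V \<and> \<gamma> ` J \<subseteq> V \<and> V \<subseteq> U \<and> C1_basis_on A V E \<and>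
            (\<forall>s\<in>J. has_components A (\<gamma> s) (\<lambda>j. E j (\<gamma> s))
                     (\<lambda>j. S_derivation S X (E j) (\<gamma> s)) 0)))"
proof -
  interpret S_derivation_on_path A J a b \<gamma> U S X
    by unfold_locales (fact manifold interval path nbhd X S[OF X(1)])+
  show ?thesis
    by (intro conjI impI normal_basis_along_path) (erule exE, rule normal_basis_near_embedded_path)
qed

end
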